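(* Suppose $d\ge3$ and $f\in\mathcal{R}_d$. Let $A_1,\dots,A_m\in\mathrm{Mat}_K(r,r)$ be nonzero and nilpotent, and assume there exist orthogonal idempotents $E_1,\dots,E_m\in\mathrm{Mat}_K(r,r)$ such that $E_iA_i=A_iE_i=A_i$ for all $i$. Let $n_i=\mathrm{index}(A_i)$ and $1\le a_i<n_i$. Assume that $A_i^k\in M_f$ for all $k\ge a_i$ and all $i=1,\dots,m$. Let $n=\sum_{i=1}^m(n_i-a_i)$. Then $f$ is a specialization of some $f_t\in\mathcal{R}_d[t_1,\dots,t_n]$ (that is, $f_0=f$, where $f_0$ is the value of $f_t$ at $t_1=\dots=t_n=0$) that splits regularly $n$ times over $K(t_1,\dots,t_n)$.
   Context: $K$ is a field, $r\ge 1$, $R=K[\partial_1,\dots,\partial_r]$ is a polynomial ring with the standard grading, and $\mathcal{R}=K[x_1,\dots,x_r]^{DP}=\bigoplus_{d\ge0}\mathcal{R}_d$ is the divided power ring: $\mathcal{R}_d$ has $K$-basis $x^{(\alpha)}=\prod_i x_i^{(\alpha_i)}$, $|\alpha|=d$, with multiplication generated by $x_i^{(a)}x_i^{(b)}=\binom{a+b}{a}x_i^{(a+b)}$. $R$ acts on $\mathcal{R}$ by $\partial^\beta(x^{(\alpha)})=x^{(\alpha-\beta)}$ (zero if some $\alpha_i<\beta_i$). $\mathrm{ann}_R(f)=\{D\in R:Df=0\}$, $R_e(f)=\{Df:D\in R_e\}$, $\partial=[\partial_1,\dots,\partial_r]^T$, and $$M_f=\{A\in\mathrm{Mat}_K(r,r):I_2(\partial\;A\partial)\subseteq\mathrm{ann}_R(f)\},$$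 where $I_2(\partial\;A\partial)$ is the ideal of $R$ generated by the $2\times2$ minors of the $r\times2$ matrix with columns $\partial$ and $A\partial$. For a nilpotent matrix $A$, $\mathrm{index}(A)=\min\{k\ge1:A^k=0\}$. Orthogonal idempotents: $E_i^2=E_i\ne0$ and $E_iE_j=0$ for $i\ne j$. $\mathcal{R}_d[t_1,\dots,t_n]=\mathcal{R}_d\otimes_KK[t_1,\dots,t_n]$, regarded inside the degree $d$ forms of the divided power ring over $K(t_1,\dots,t_n)$. A form $f$ of degree $d$ (over any field) splits regularly $n$ times if $f=g_1+\dots+g_{n+1}$ with nonzero forms $g_i$ of degree $d$ such that $R_{d-1}(g_i)\cap\sum_{j\ne i}R_{d-1}(g_j)=0$ for all $i$; over $K(t_1,\dots,t_n)$, $R$ is replaced by $R\otimes_KK(t_1,\dots,t_n)$. *)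

theory Defs
  imports
    "HOL-Analysis.Analysis"
    "HOL-Library.Poly_Mapping"
    "HOL-Computational_Algebra.Fraction_Field"
begin

type_synonym ('v, 'k) mpoly = "('v \<Rightarrow>\<^sub>0 nat) \<Rightarrow>\<^sub>0 'k"

text \<open>
  Elements of the divided power ring are given by their coefficients in the basis of the
  divided power monomials. The HOL type coincides with that of polynomials, but the
  product of the type class is the polynomial product and is never applied to it. Only
  the vector space structure and the action of polynomials below are used, not the
  divided power product.
\<close>
type_synonym ('v, 'k) divpow = "('v \<Rightarrow>\<^sub>0 nat) \<Rightarrow>\<^sub>0 'k"

definition mdeg :: "('v::finite \<Rightarrow>\<^sub>0 nat) \<Rightarrow> nat" where
  "mdeg \<alpha> = (\<Sum>i\<in>UNIV. Poly_Mapping.lookup \<alpha> i)"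

text \<open>Homogeneous elements of degree \<open>d\<close> (zero included), both for \<open>mpoly\<close> and for \<open>divpow\<close>.\<close>
definition forms :: "nat \<Rightarrow> (('v::finite \<Rightarrow>\<^sub>0 nat) \<Rightarrow>\<^sub>0 'k::zero) set" where
  "forms d = {f. \<forall>\<alpha>\<in>Poly_Mapping.keys f. mdeg \<alpha> = d}"

text \<open>
  The divisibility order on exponents is spelled out pointwise, because \<open>\<le>\<close> on
  \<open>'v \<Rightarrow>\<^sub>0 nat\<close> is a lexicographic order.
\<close>
definition act :: "('v, 'k::field) mpoly \<Rightarrow> ('v, 'k) divpow \<Rightarrow> ('v, 'k) divpow" where
  "act D f =
    (\<Sum>\<beta>\<in>Poly_Mapping.keys D. \<Sum>\<alpha>\<in>Poly_Mapping.keys f.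
      if \<forall>i. Poly_Mapping.lookup \<beta> i \<le> Poly_Mapping.lookup \<alpha> i
      then Poly_Mapping.single (\<alpha> - \<beta>) (Poly_Mapping.lookup D \<beta> * Poly_Mapping.lookup f \<alpha>)
      else 0)"

lemma act_monomial:
  "act (Poly_Mapping.single \<beta> 1) (Poly_Mapping.single \<alpha> (1::'k::field)) =
    (if \<forall>i. Poly_Mapping.lookup \<beta> i \<le> Poly_Mapping.lookup \<alpha> i
     then Poly_Mapping.single (\<alpha> - \<beta>) 1 else 0)"
  by (auto simp: act_def intro!: sum.neutral split: if_splits)

definition ann :: "('v, 'k::field) divpow \<Rightarrow> ('v, 'k) mpoly set" where
  "ann f = {D. act D f = 0}"

text \<open>The space \<open>R\<^sub>e(f)\<close>.\<close>
definition derivs :: "nat \<Rightarrow> ('v::finite, 'k::field) divpow \<Rightarrow> ('v, 'k) divpow set" where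
  "derivs e f = (\<lambda>D. act D f) ` forms e"

definition pvar :: "'v \<Rightarrow> ('v, 'k::field) mpoly" where
  "pvar i = Poly_Mapping.single (Poly_Mapping.single i 1) 1"

definition pvec :: "('v::finite, 'k::field) mpoly ^ 'v" where
  "pvec = (\<chi> i. pvar i)"

definition pconst_mat :: "'k::field ^ 'v ^ 'v \<Rightarrow> ('v::finite, 'k) mpoly ^ 'v ^ 'v" where
  "pconst_mat A = (\<chi> i j. Poly_Mapping.single 0 (A $ i $ j))"

definition minors2 :: "'a::comm_ring_1 ^ 'v \<Rightarrow> 'a ^ 'v \<Rightarrow> 'a set" where
  "minors2 u v = {u $ i * v $ j - u $ j * v $ i | i j. True}"

text \<open>The span in a ring regarded as a module over itself is the generated ideal.\<close>
definition ideal_gen :: "'a::comm_ring_1 set \<Rightarrow> 'a set" where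
  "ideal_gen S = module.span (*) S"

lemma ideal_gen_explicit:
  "ideal_gen S = {(\<Sum>s\<in>T. c s * s) | T c. finite T \<and> T \<subseteq> (S :: 'a::comm_ring_1 set)}"
proof -
  interpret module "(*) :: 'a \<Rightarrow> 'a \<Rightarrow> 'a"
    by unfold_locales (simp_all add: algebra_simps)
  show ?thesis unfolding ideal_gen_def by (rule span_explicit)
qed

definition M_alg :: "('v::finite, 'k::field) divpow \<Rightarrow> ('k ^ 'v ^ 'v) set" where
  "M_alg f = {A. ideal_gen (minors2 pvec (pconst_mat A *v pvec)) \<subseteq> ann f}"

text \<open>The class operation \<open>^\<close> on \<open>'k ^ 'v ^ 'v\<close> would be the entrywise power.\<close>
definition matpow :: "'k::field ^ 'v ^ 'v \<Rightarrow> nat \<Rightarrow> 'k ^ 'v ^ ('v::finite)" where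
  "matpow A k = (((**) A) ^^ k) (mat 1)"

definition nilpotent_mat :: "'k::field ^ 'v ^ 'v::finite \<Rightarrow> bool" where
  "nilpotent_mat A \<longleftrightarrow> (\<exists>k\<ge>1. matpow A k = 0)"

definition nil_index :: "'k::field ^ 'v ^ 'v::finite \<Rightarrow> nat" where
  "nil_index A = (LEAST k. 1 \<le> k \<and> matpow A k = 0)"

definition orthogonal_idempotents :: "nat set \<Rightarrow> (nat \<Rightarrow> 'k::field ^ 'v ^ 'v::finite) \<Rightarrow> bool" where
  "orthogonal_idempotents I E \<longleftrightarrow>
    (\<forall>i\<in>I. E i ** E i = E i \<and> E i \<noteq> 0) \<and>
    (\<forall>i\<in>I. \<forall>j\<in>I. i \<noteq> j \<longrightarrow> E i ** E j = 0)"

definition splits_regularly :: "nat \<Rightarrow> nat \<Rightarrow> ('v::finite, 'k::field) divpow \<Rightarrow> bool" where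
  "splits_regularly n d f \<longleftrightarrow>
    (\<exists>g. (\<forall>i\<in>{1..n+1}. g i \<in> forms d \<and> g i \<noteq> 0) \<and>
         f = (\<Sum>i\<in>{1..n+1}. g i) \<and>
         (\<forall>i\<in>{1..n+1}.
            derivs (d - 1) (g i) \<inter>
            {(\<Sum>j\<in>{1..n+1} - {i}. h j) | h. \<forall>j\<in>{1..n+1} - {i}. h j \<in> derivs (d - 1) (g j)}
            = {0}))"

definition poly_eval :: "('t \<Rightarrow> 'k::field) \<Rightarrow> ('t::finite, 'k) mpoly \<Rightarrow> 'k" where
  "poly_eval c p =
    (\<Sum>\<alpha>\<in>Poly_Mapping.keys p. Poly_Mapping.lookup p \<alpha> * (\<Prod>i\<in>UNIV. c i ^ Poly_Mapping.lookup \<alpha> i))"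

text \<open>
  An element of \<open>\<R>[t]\<close> is a divided power element with coefficients in the polynomial ring
  \<open>K[t]\<close> whose variables are indexed by the finite type \<open>'t\<close>. The order on \<open>'t\<close> has no
  mathematical meaning: the library needs it for the fact that \<open>K[t]\<close> is an integral domain, so
  that the type of fractions is the field \<open>K(t)\<close>.
\<close>
definition specialize :: "('t \<Rightarrow> 'k::field) \<Rightarrow> ('v, ('t::finite, 'k) mpoly) divpow \<Rightarrow> ('v, 'k) divpow"
  where "specialize c F = Poly_Mapping.map (poly_eval c) F"

definition to_fraction_field ::
  "('v, ('t::{finite,linorder}, 'k::field) mpoly) divpow \<Rightarrow> ('v, ('t, 'k) mpoly fract) divpow"
  where "to_fraction_field F = Poly_Mapping.map (\<lambda>p. Fract p 1) F"

end

theory Submission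
  imports Defs
begin

text \<open>
  A form \<open>f\<close> of degree \<open>d\<close> is the same as a symmetric \<open>d\<close>-linear functional
  \<open>F(u\<^sub>1, \<dots>, u\<^sub>d)\<close> on the space \<open>U\<close> of linear operators \<open>\<Sum> u\<^sub>i \<partial>\<^sub>i\<close>: apply all operators
  to \<open>f\<close>. In this language \<open>A \<in> M\<^sub>f\<close> says that \<open>A\<close>, acting on row vectors, is self-adjoint for
  \<open>F\<close>, that is \<open>F(uA, v, \<dots>) = F(u, vA, \<dots>)\<close> (\<open>M_alg_ddir\<close>).

  For every \<open>i\<close> the range of \<open>E\<^sub>i\<close> on row vectors has a basis of chains \<open>h, hA\<^sub>i, hA\<^sub>i\<^sup>2, \<dots>\<close>, by the Jordan form of
  the nilpotent matrix \<open>A\<^sub>i\<close>; together with a basis of the complement (a further block, with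
  the zero matrix) they form a basis of \<open>U\<close> (\<open>joint_chain_basis\<close>). Evaluate \<open>F\<close> on vectors
  \<open>h\<^sub>j A\<^sub>i\<^bsup>k\<^sub>j\<^esup>\<close> of one block, with at least one depth \<open>k\<^sub>j \<ge> a\<^sub>i\<close>. Powers from \<open>a\<^sub>i\<close> on
  may be moved from one argument to another, so the value depends only on the heads \<open>h\<^sub>j\<close> and on
  the total depth \<open>s = \<Sum> k\<^sub>j\<close>, and it is \<open>0\<close> once \<open>s\<close> reaches the length \<open>\<mu>\<close> of the shortest
  chain involved (\<open>pull_deep\<close>, \<open>chain_value_eq_0\<close>). If a further argument lies in another
  block, then the value is \<open>0\<close> (\<open>pull_mixed\<close>).

  For fixed heads the values therefore form a sequence \<open>\<phi>\<^sub>s\<close>, \<open>s \<ge> a\<^sub>i\<close>, with \<open>\<phi>\<^sub>s = 0\<close> for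
  \<open>s \<ge> \<mu>\<close>; it satisfies the recurrence with characteristic polynomial \<open>z\<^bsup>\<mu> - a\<^sub>i\<^esup>\<close>.
  The deformation replaces this polynomial by \<open>\<Prod> (z - t\<^sub>q)\<close>, \<open>1 \<le> q \<le> \<mu> - a\<^sub>i\<close>, with distinct
  nonzero roots, and keeps the initial values \<open>\<phi>\<^sub>s\<close>, \<open>s < \<mu>\<close>. The new sequence has
  polynomial entries, specializes to the old one at \<open>t = 0\<close>, and over the field of fractions
  it is a combination \<open>\<Sum> w\<^sub>q t\<^sub>q\<^sup>s\<close> of geometric sequences (\<open>newton_interpolation\<close>). One variable
  \<open>\<tau>\<close> provides all roots, as \<open>t\<^sub>q = \<tau>\<^sup>q\<close>.

  The term with index \<open>q\<close> in block \<open>i\<close> is a form whose derivatives of order \<open>d - 1\<close> are linear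
  forms with values \<open>t\<^sub>q\<^sup>k z(h)\<close> at the vectors \<open>hA\<^sub>i\<^sup>k\<close>, with \<open>z(h) = 0\<close> if the chain of \<open>h\<close> is
  shorter than \<open>a\<^sub>i + q\<close>. What remains of the deformed form after subtracting all these terms
  vanishes as soon as one argument has depth at least \<open>a\<^sub>i\<close>. The resulting spaces of linear forms are
  independent because a Vandermonde system has only the trivial solution (\<open>component_spaces_independent\<close>), and this is regularity
  of the splitting (\<open>splits_regularly_criterion\<close>). The number of terms is
  \<open>\<Sum> (n\<^sub>i - a\<^sub>i) + 1\<close>, because the longest chain in block \<open>i\<close> has length \<open>n\<^sub>i\<close>. A term that is
  zero is replaced by \<open>\<tau>\<close> times a pure power from its space, which does not affect the
  value at \<open>\<tau> = 0\<close> (\<open>deformed_form_nonzero\<close>).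
\<close>

section \<open>Forms as symmetric multilinear functionals\<close>

text \<open>
  A form is represented by the function that maps the multiset of the indices
  of the variables in a divided power monomial to the coefficient at this monomial. Contraction by
  \<open>\<partial>\<^sub>i\<close> then inserts the index \<open>i\<close>, and \<open>ddir u\<close> is the action of the operator \<open>\<Sum> u\<^sub>i \<partial>\<^sub>i\<close>. Forms of all
  degrees are treated at once: a function need not be supported in a single degree.
\<close>
definition ddir :: "'a::comm_ring_1 ^ 'r::finite \<Rightarrow> ('r multiset \<Rightarrow> 'a) \<Rightarrow> 'r multiset \<Rightarrow> 'a" where
  "ddir u \<Phi> = (\<lambda>M. \<Sum>i\<in>UNIV. u $ i * \<Phi> (add_mset i M))"

text \<open>
  The symmetric multilinear functional of a form. Contractions commute, so folding over a
  multiset of vectors makes sense and symmetry is built in.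
\<close>
definition mform :: "('r multiset \<Rightarrow> 'a) \<Rightarrow> ('a::comm_ring_1 ^ 'r::finite) multiset \<Rightarrow> 'a" where
  "mform \<Phi> us = fold_mset ddir \<Phi> us {#}"

lemma ddir_commute: "ddir u (ddir v \<Phi>) = ddir v (ddir u \<Phi>)"
proof
  fix M
  have "ddir u (ddir v \<Phi>) M =
      (\<Sum>i\<in>UNIV. \<Sum>j\<in>UNIV. u $ i * v $ j * \<Phi> (add_mset j (add_mset i M)))"
    by (simp add: ddir_def sum_distrib_left mult.assoc)
  also have "\<dots> = (\<Sum>j\<in>UNIV. \<Sum>i\<in>UNIV. u $ i * v $ j * \<Phi> (add_mset j (add_mset i M)))"
    by (rule sum.swap)
  also have "\<dots> = ddir v (ddir u \<Phi>) M"
    by (simp add: ddir_def sum_distrib_left ac_simps add_mset_commute)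
  finally show "ddir u (ddir v \<Phi>) M = ddir v (ddir u \<Phi>) M" .
qed

lemma comp_fun_commute_ddir: "comp_fun_commute ddir"
  by standard (simp add: fun_eq_iff ddir_commute)

lemma mform_empty [simp]: "mform \<Phi> {#} = \<Phi> {#}"
  by (simp add: mform_def)

lemma mform_add [simp]: "mform \<Phi> (add_mset u us) = mform (ddir u \<Phi>) us"
  by (simp add: mform_def comp_fun_commute.fold_mset_add_mset[OF comp_fun_commute_ddir]
      comp_fun_commute.fold_mset_fun_left_comm[OF comp_fun_commute_ddir])

lemma ddir_sum: "ddir u (\<lambda>M. \<Sum>x\<in>X. c x * \<Phi> x M) = (\<lambda>M. \<Sum>x\<in>X. c x * ddir u (\<Phi> x) M)"
proof
  fix M
  have "ddir u (\<lambda>M. \<Sum>x\<in>X. c x * \<Phi> x M) M =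
      (\<Sum>i\<in>UNIV. \<Sum>x\<in>X. c x * (u $ i * \<Phi> x (add_mset i M)))"
    by (simp add: ddir_def sum_distrib_left mult.left_commute)
  also have "\<dots> = (\<Sum>x\<in>X. \<Sum>i\<in>UNIV. c x * (u $ i * \<Phi> x (add_mset i M)))"
    by (rule sum.swap)
  finally show "ddir u (\<lambda>M. \<Sum>x\<in>X. c x * \<Phi> x M) M = (\<Sum>x\<in>X. c x * ddir u (\<Phi> x) M)"
    by (simp add: ddir_def sum_distrib_left)
qed

lemma mform_sum: "mform (\<lambda>M. \<Sum>x\<in>X. c x * \<Phi> x M) us = (\<Sum>x\<in>X. c x * mform (\<Phi> x) us)"
  by (induction us arbitrary: \<Phi>) (simp_all add: ddir_sum)

lemma mform_sum1: "mform (\<lambda>M. \<Sum>x\<in>X. \<Phi> x M) us = (\<Sum>x\<in>X. mform (\<Phi> x) us)"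
  using mform_sum[of "\<lambda>_. 1" \<Phi> X us] by simp

lemma ddir_zero [simp]: "ddir 0 \<Phi> = (\<lambda>_. 0)"
  by (simp add: ddir_def fun_eq_iff)

lemma ddir_zero_fun [simp]: "ddir u (\<lambda>_. 0) = (\<lambda>_. 0)"
  by (simp add: ddir_def)

lemma mform_zero_fun [simp]: "mform (\<lambda>_. 0) us = 0"
  by (induction us) simp_all

lemma mform_ddir: "mform (ddir u \<Phi>) us = (\<Sum>i\<in>UNIV. u $ i * mform (\<lambda>M. \<Phi> (add_mset i M)) us)"
  unfolding ddir_def by (rule mform_sum)

lemma mform_cong_size:
  assumes "\<And>M. size M = size us \<Longrightarrow> \<Phi> M = \<Psi> M"
  shows "mform \<Phi> us = mform \<Psi> us"
  using assms
proof (induction us arbitrary: \<Phi> \<Psi>)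
  case (add u us)
  show ?case
    by (simp, rule add.IH) (auto simp: ddir_def add.prems)
qed simp

text \<open>
  Specialization and the passage to the field of fractions are homomorphisms of the coefficients;
  they act on a form after a change of coordinates through the coefficients of the form and of the
  matrix.
\<close>
lemma mform_hom:
  fixes \<eta> :: "'a::comm_ring_1 \<Rightarrow> 'b::comm_ring_1"
  assumes add: "\<And>x y. \<eta> (x + y) = \<eta> x + \<eta> y" and mult: "\<And>x y. \<eta> (x * y) = \<eta> x * \<eta> y"
  shows "\<eta> (mform \<Phi> us) = mform (\<lambda>M. \<eta> (\<Phi> M)) (image_mset (\<lambda>u. \<chi> i. \<eta> (u $ i)) us)"
proof (induction us arbitrary: \<Phi>)
  case (add u us)
  have "\<eta> 0 = 0"
    using assms(1)[of 0 0] by simp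
  then have sum: "\<eta> (sum h S) = (\<Sum>x\<in>S. \<eta> (h x))" for h :: "'r \<Rightarrow> 'a" and S
    by (induction S rule: infinite_finite_induct) (simp_all add: assms(1))
  show ?case
    by (simp add: add.IH ddir_def sum mult)
qed simp

text \<open>
  The form in the coordinates whose basis vectors are the rows of \<open>C\<close>.
\<close>
definition pull :: "'a::comm_ring_1 ^ 'r::finite ^ 'r \<Rightarrow> ('r multiset \<Rightarrow> 'a) \<Rightarrow> 'r multiset \<Rightarrow> 'a" where
  "pull C \<Phi> M = mform \<Phi> (image_mset (\<lambda>i. C $ i) M)"

lemma pull_empty [simp]: "pull C \<Phi> {#} = \<Phi> {#}"
  by (simp add: pull_def)

lemma pull_add [simp]: "pull C \<Phi> (add_mset i M) = pull C (ddir (C $ i) \<Phi>) M"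
  by (simp add: pull_def)

lemma ddir_vector_matrix: "ddir (u v* C) \<Phi> M = (\<Sum>i\<in>UNIV. u $ i * ddir (C $ i) \<Phi> M)"
proof -
  have "ddir (u v* C) \<Phi> M =
      (\<Sum>j\<in>UNIV. \<Sum>i\<in>UNIV. u $ i * (C $ i $ j * \<Phi> (add_mset j M)))"
    by (simp add: ddir_def vector_matrix_mult_def sum_distrib_right mult.assoc)
  also have "\<dots> = (\<Sum>i\<in>UNIV. \<Sum>j\<in>UNIV. u $ i * (C $ i $ j * \<Phi> (add_mset j M)))"
    by (rule sum.swap)
  finally show "ddir (u v* C) \<Phi> M = (\<Sum>i\<in>UNIV. u $ i * ddir (C $ i) \<Phi> M)"
    by (simp add: ddir_def sum_distrib_left)
qed

lemma ddir_pull: "ddir u (pull C \<Phi>) = pull C (ddir (u v* C) \<Phi>)"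
proof
  fix M
  have "ddir (u v* C) \<Phi> = (\<lambda>M. \<Sum>i\<in>UNIV. u $ i * ddir (C $ i) \<Phi> M)"
    by (simp add: fun_eq_iff ddir_vector_matrix)
  then show "ddir u (pull C \<Phi>) M = pull C (ddir (u v* C) \<Phi>) M"
    by (simp add: ddir_def[of u "pull C \<Phi>"]) (simp add: pull_def mform_sum)
qed

lemma pull_pull: "pull B (pull C \<Phi>) = pull (B ** C) \<Phi>"
proof
  fix M show "pull B (pull C \<Phi>) M = pull (B ** C) \<Phi> M"
  proof (induction M arbitrary: \<Phi>)
    case (add i M)
    have "B $ i v* C = (B ** C) $ i"
      by (simp add: vec_eq_iff vector_matrix_mult_def matrix_matrix_mult_def)
    then show ?case
      by (simp add: ddir_pull add.IH)
  qed simp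
qed

lemma ddir_axis: "ddir (mat 1 $ i) \<Phi> M = \<Phi> (add_mset i M)"
  by (simp add: ddir_def mat_def if_distrib[of "\<lambda>x. x * _"] cong: if_cong)

lemma pull_one [simp]: "pull (mat 1) \<Phi> = \<Phi>"
proof
  fix M show "pull (mat 1) \<Phi> M = \<Phi> M"
    by (induction M arbitrary: \<Phi>) (simp_all add: ddir_axis)
qed

text \<open>
  If all derivatives of order \<open>d - 1\<close> lie in a space \<open>V\<close> of linear forms, then after a change of
  coordinates they lie in the image of \<open>V\<close>: contraction by a vector preserves membership in \<open>V\<close>
  because \<open>V\<close> is closed under linear combinations.
\<close>
lemma pull_mem_image:
  fixes V :: "('a::field ^ 'r::finite) set"
  assumes V: "vec.subspace V" and mem: "\<And>M. (\<chi> i. \<Psi> (add_mset i M)) \<in> V"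
  shows "(\<chi> i. pull C \<Psi> (add_mset i M)) \<in> (*v) C ` V"
proof -
  have *: "(\<chi> i. mform (\<lambda>M. \<Psi> (add_mset i M)) us) \<in> V" for us
    using mem
  proof (induction us arbitrary: \<Psi>)
    case (add u us)
    have "(\<chi> i. ddir u \<Psi> (add_mset i M)) \<in> V" for M
    proof -
      have "(\<chi> i. ddir u \<Psi> (add_mset i M)) =
          (\<Sum>j\<in>UNIV. u $ j *s (\<chi> i. \<Psi> (add_mset i (add_mset j M))))"
        by (simp add: vec_eq_iff ddir_def add_mset_commute)
      also have "\<dots> \<in> V"
        by (intro vec.subspace_sum[OF V] vec.subspace_scale[OF V] add.prems)
      finally show ?thesis .
    qed
    from add.IH[OF this] show ?case
      by (simp add: ddir_def add_mset_commute)
  qed simp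
  have "(\<chi> i. pull C \<Psi> (add_mset i M)) =
      C *v (\<chi> i. mform (\<lambda>M. \<Psi> (add_mset i M)) (image_mset (\<lambda>i. C $ i) M))"
    by (simp add: vec_eq_iff pull_def mform_ddir matrix_vector_mult_def)
  then show ?thesis
    using * by blast
qed

section \<open>Exponents and a criterion for regular splittings\<close>

definition expo :: "'r multiset \<Rightarrow> 'r \<Rightarrow>\<^sub>0 nat" where
  "expo M = (\<Sum>i\<in>#M. Poly_Mapping.single i 1)"

definition mset_of :: "('r::finite \<Rightarrow>\<^sub>0 nat) \<Rightarrow> 'r multiset" where
  "mset_of \<alpha> = (\<Sum>i\<in>UNIV. replicate_mset (Poly_Mapping.lookup \<alpha> i) i)"

lemma lookup_expo [simp]: "Poly_Mapping.lookup (expo M) i = count M i"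
  by (induction M) (auto simp: expo_def lookup_add lookup_single)

lemma count_mset_of [simp]: "count (mset_of \<alpha>) i = Poly_Mapping.lookup \<alpha> i"
  by (simp add: mset_of_def count_sum)

lemma expo_mset_of [simp]: "expo (mset_of \<alpha>) = \<alpha>"
  by (rule poly_mapping_eqI) simp

lemma mset_of_expo [simp]: "mset_of (expo M) = M"
  by (rule multiset_eqI) simp

lemma mdeg_expo [simp]: "mdeg (expo M) = size M"
proof (induction M)
  case (add i M)
  have "(\<Sum>j\<in>UNIV. count (add_mset i M) j) = (\<Sum>j\<in>UNIV. (if j = i then 1 else 0) + count M j)"
    by (intro sum.cong) auto
  with add show ?case
    by (simp add: mdeg_def sum.distrib)
qed (simp add: mdeg_def)

lemma size_mset_of [simp]: "size (mset_of \<alpha>) = mdeg \<alpha>"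
  by (metis expo_mset_of mdeg_expo)

lemma finite_mdeg: "finite {\<alpha> :: 'r::finite \<Rightarrow>\<^sub>0 nat. mdeg \<alpha> = d}"
proof (rule finite_subset)
  show "{\<alpha> :: 'r \<Rightarrow>\<^sub>0 nat. mdeg \<alpha> = d} \<subseteq> (\<lambda>xs. expo (mset xs)) ` {xs. set xs \<subseteq> UNIV \<and> length xs = d}"
  proof
    fix \<alpha> :: "'r \<Rightarrow>\<^sub>0 nat" assume \<alpha>: "\<alpha> \<in> {\<alpha>. mdeg \<alpha> = d}"
    obtain xs where xs: "mset xs = mset_of \<alpha>"
      using ex_mset by blast
    then have "length xs = d"
      using \<alpha> by (metis mem_Collect_eq size_mset size_mset_of)
    with xs show "\<alpha> \<in> (\<lambda>xs. expo (mset xs)) ` {xs. set xs \<subseteq> UNIV \<and> length xs = d}"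
      by (auto intro!: image_eqI[of _ _ xs])
  qed
qed (intro finite_imageI finite_lists_length_eq, simp)

definition form_of :: "nat \<Rightarrow> ('r::finite multiset \<Rightarrow> 'a::zero) \<Rightarrow> ('r \<Rightarrow>\<^sub>0 nat) \<Rightarrow>\<^sub>0 'a" where
  "form_of d \<Phi> = Abs_poly_mapping (\<lambda>\<alpha>. if mdeg \<alpha> = d then \<Phi> (mset_of \<alpha>) else 0)"

lemma lookup_form_of [simp]:
  "Poly_Mapping.lookup (form_of d \<Phi>) \<alpha> = (if mdeg \<alpha> = d then \<Phi> (mset_of \<alpha>) else 0)"
proof -
  have "finite {\<alpha>. (if mdeg \<alpha> = d then \<Phi> (mset_of \<alpha>) else 0) \<noteq> 0}"
    by (rule finite_subset[OF _ finite_mdeg[of d]]) auto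
  then show ?thesis
    by (simp add: form_of_def Abs_poly_mapping_inverse)
qed

lemma form_of_in_forms: "form_of d \<Phi> \<in> forms d"
  by (auto simp: forms_def in_keys_iff split: if_splits)

lemma forms_lookup_eq_0: "f \<in> forms d \<Longrightarrow> mdeg \<alpha> \<noteq> d \<Longrightarrow> Poly_Mapping.lookup f \<alpha> = 0"
  by (auto simp: forms_def in_keys_iff)

lemma lookup_act:
  assumes "finite S" "Poly_Mapping.keys D \<subseteq> S"
  shows "Poly_Mapping.lookup (act D f) \<gamma> =
    (\<Sum>\<beta>\<in>S. Poly_Mapping.lookup D \<beta> * Poly_Mapping.lookup f (\<beta> + \<gamma>))"
proof -
  have "Poly_Mapping.lookup (if \<forall>i. Poly_Mapping.lookup \<beta> i \<le> Poly_Mapping.lookup \<alpha> i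
      then Poly_Mapping.single (\<alpha> - \<beta>) (Poly_Mapping.lookup D \<beta> * Poly_Mapping.lookup f \<alpha>)
      else 0) \<gamma> = (if \<alpha> = \<beta> + \<gamma> then Poly_Mapping.lookup D \<beta> * Poly_Mapping.lookup f \<alpha> else 0)"
    for \<alpha> \<beta>
  proof -
    have "(\<forall>i. Poly_Mapping.lookup \<beta> i \<le> Poly_Mapping.lookup \<alpha> i) \<and> \<alpha> - \<beta> = \<gamma> \<longleftrightarrow> \<alpha> = \<beta> + \<gamma>"
      by (auto simp: poly_mapping_eq_iff fun_eq_iff lookup_add lookup_minus)
        (metis le_add_diff_inverse)
    then show ?thesis
      by (auto simp: lookup_single when_def)
  qed
  then have "Poly_Mapping.lookup (act D f) \<gamma> = (\<Sum>\<beta>\<in>Poly_Mapping.keys D. \<Sum>\<alpha>\<in>Poly_Mapping.keys f.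
      if \<alpha> = \<beta> + \<gamma> then Poly_Mapping.lookup D \<beta> * Poly_Mapping.lookup f \<alpha> else 0)"
    by (simp add: act_def lookup_sum)
  also have "\<dots> = (\<Sum>\<beta>\<in>Poly_Mapping.keys D. Poly_Mapping.lookup D \<beta> * Poly_Mapping.lookup f (\<beta> + \<gamma>))"
    by (intro sum.cong) (auto simp: in_keys_iff)
  also have "\<dots> = (\<Sum>\<beta>\<in>S. Poly_Mapping.lookup D \<beta> * Poly_Mapping.lookup f (\<beta> + \<gamma>))"
    using assms by (intro sum.mono_neutral_left) (auto simp: in_keys_iff)
  finally show ?thesis .
qed

text \<open>
  A linear form is written as \<open>form_of 1\<close> of its coefficient vector; the sum over the one-element
  multiset is the coefficient at its element.
\<close>
lemma derivs_subset:
  fixes V :: "('k::field ^ 'r::finite) set"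
  assumes V: "vec.subspace V" and d: "d \<ge> 1"
    and mem: "\<And>M. (\<chi> i. \<Psi> (add_mset i M)) \<in> V"
    and h: "h \<in> derivs (d - 1) (form_of d \<Psi>)"
  shows "\<exists>y\<in>V. h = form_of 1 (\<lambda>M. \<Sum>i\<in>#M. y $ i)"
proof -
  obtain D where D: "D \<in> forms (d - 1)" "h = act D (form_of d \<Psi>)"
    using h by (auto simp: derivs_def)
  define y where "y = (\<Sum>\<beta>\<in>Poly_Mapping.keys D. Poly_Mapping.lookup D \<beta> *s (\<chi> i. \<Psi> (add_mset i (mset_of \<beta>))))"
  have "y \<in> V"
    unfolding y_def by (intro vec.subspace_sum[OF V] vec.subspace_scale[OF V] mem)
  moreover have "Poly_Mapping.lookup h (expo M) = Poly_Mapping.lookup (form_of 1 (\<lambda>M. \<Sum>i\<in>#M. y $ i)) (expo M)" for M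
  proof -
    have sum_eq: "\<beta> + expo M = expo (mset_of \<beta> + M)" for \<beta>
      by (rule poly_mapping_eqI) (simp add: lookup_add)
    have deg: "mdeg \<beta> = d - 1" if "\<beta> \<in> Poly_Mapping.keys D" for \<beta>
      using D that by (auto simp: forms_def)
    have "Poly_Mapping.lookup h (expo M) = (\<Sum>\<beta>\<in>Poly_Mapping.keys D. Poly_Mapping.lookup D \<beta> *
        (if size M = 1 then \<Psi> (mset_of \<beta> + M) else 0))"
      using d by (auto simp: D lookup_act[OF _ order_refl] sum_eq deg intro!: sum.cong)
    also have "\<dots> = Poly_Mapping.lookup (form_of 1 (\<lambda>M. \<Sum>i\<in>#M. y $ i)) (expo M)"
    proof (cases "size M = 1")
      case True
      then obtain i where "M = {#i#}"
        using size_1_singleton_mset by blast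
      then show ?thesis
        by (simp add: y_def)
    qed simp
    finally show ?thesis .
  qed
  then have "h = form_of 1 (\<lambda>M. \<Sum>i\<in>#M. y $ i)"
    by (metis expo_mset_of poly_mapping_eqI)
  ultimately show ?thesis by blast
qed

text \<open>
  The spaces of derivatives of order \<open>d - 1\<close> intersect trivially in the sense of a regular splitting
  as soon as they are contained in an independent family of spaces of linear forms.
\<close>
lemma splits_regularly_criterion:
  fixes G :: "'x \<Rightarrow> 'r::finite multiset \<Rightarrow> 'k::field" and V :: "'x \<Rightarrow> ('k ^ 'r) set"
  assumes X: "finite X" "card X = n + 1" and d: "d \<ge> 1"
    and V: "\<And>x. x \<in> X \<Longrightarrow> vec.subspace (V x)"
    and indep: "\<And>y. (\<And>x. x \<in> X \<Longrightarrow> y x \<in> V x) \<Longrightarrow> (\<Sum>x\<in>X. y x) = 0 \<Longrightarrow> \<forall>x\<in>X. y x = 0"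
    and mem: "\<And>x M. x \<in> X \<Longrightarrow> (\<chi> i. G x (add_mset i M)) \<in> V x"
    and nz: "\<And>x. x \<in> X \<Longrightarrow> \<exists>M. size M = d \<and> G x M \<noteq> 0"
  shows "splits_regularly n d (form_of d (\<lambda>M. \<Sum>x\<in>X. G x M))"
proof -
  obtain \<theta> where \<theta>: "bij_betw \<theta> {1..n+1} X"
    using X by (metis card_atLeastAtMost diff_Suc_1 finite_atLeastAtMost finite_same_card_bij Suc_eq_plus1)
  have \<theta>X: "\<theta> i \<in> X" if "i \<in> {1..n+1}" for i
    using \<theta> that bij_betwE by blast
  define L where "L = (\<lambda>y :: 'k ^ 'r. form_of 1 (\<lambda>M. \<Sum>i\<in>#M. y $ i))"
  define g where "g i = form_of d (G (\<theta> i))" for i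
  have L_sum: "(\<Sum>i\<in>I. L (y i)) = L (\<Sum>i\<in>I. y i)" for I and y :: "nat \<Rightarrow> 'k ^ 'r"
  proof (rule poly_mapping_eqI)
    fix \<alpha> :: "'r \<Rightarrow>\<^sub>0 nat"
    show "Poly_Mapping.lookup (\<Sum>i\<in>I. L (y i)) \<alpha> = Poly_Mapping.lookup (L (\<Sum>i\<in>I. y i)) \<alpha>"
    proof (cases "mdeg \<alpha> = 1")
      case True
      then obtain i where "mset_of \<alpha> = {#i#}"
        by (metis size_1_singleton_mset size_mset_of)
      with True show ?thesis
        by (simp add: L_def lookup_sum)
    qed (simp add: L_def lookup_sum)
  qed
  have L_inj: "y = z" if "L y = L z" for y z
  proof -
    have "y $ i = z $ i" for i
    proof -
      have "Poly_Mapping.lookup (L y) (expo {#i#}) = Poly_Mapping.lookup (L z) (expo {#i#})"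
        using that by simp
      then show ?thesis
        by (simp add: L_def)
    qed
    then show ?thesis by (simp add: vec_eq_iff)
  qed
  have L0: "L 0 = 0"
    using L_sum[of "\<lambda>_. 0" "{}"] by simp
  have derivs_L: "\<exists>y\<in>V (\<theta> i). h = L y" if "i \<in> {1..n+1}" "h \<in> derivs (d - 1) (g i)" for i h
    unfolding L_def
    by (rule derivs_subset[OF V d]) (use that mem \<theta>X in \<open>auto simp: g_def\<close>)
  have zero_derivs: "0 \<in> derivs (d - 1) F" for F :: "('r, 'k) divpow"
    unfolding derivs_def by (rule image_eqI[of _ _ 0]) (auto simp: act_def forms_def)
  have "derivs (d - 1) (g i) \<inter>
      {(\<Sum>j\<in>{1..n+1} - {i}. h j) | h. \<forall>j\<in>{1..n+1} - {i}. h j \<in> derivs (d - 1) (g j)} = {0}"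
    if i: "i \<in> {1..n+1}" for i
  proof (intro equalityI subsetI)
    fix p assume p: "p \<in> derivs (d - 1) (g i) \<inter>
      {(\<Sum>j\<in>{1..n+1} - {i}. h j) | h. \<forall>j\<in>{1..n+1} - {i}. h j \<in> derivs (d - 1) (g j)}"
    then obtain h where h: "p = (\<Sum>j\<in>{1..n+1} - {i}. h j)"
      "\<And>j. j \<in> {1..n+1} - {i} \<Longrightarrow> h j \<in> derivs (d - 1) (g j)" by blast
    obtain yi where yi: "yi \<in> V (\<theta> i)" "p = L yi"
      using derivs_L[OF i] p by blast
    have "\<forall>j\<in>{1..n+1} - {i}. \<exists>y\<in>V (\<theta> j). h j = L y"
      using derivs_L h(2) by blast
    then obtain z where z: "\<And>j. j \<in> {1..n+1} - {i} \<Longrightarrow> z j \<in> V (\<theta> j) \<and> h j = L (z j)"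
      by metis
    define y where "y j = (if j = i then - yi else z j)" for j
    have "L yi = L (\<Sum>j\<in>{1..n+1} - {i}. z j)"
      unfolding yi(2)[symmetric] h(1) L_sum[symmetric] using z by (intro sum.cong) auto
    then have "yi = (\<Sum>j\<in>{1..n+1} - {i}. z j)"
      by (rule L_inj)
    moreover have "(\<Sum>j\<in>{1..n+1} - {i}. y j) = (\<Sum>j\<in>{1..n+1} - {i}. z j)"
      by (intro sum.cong) (auto simp: y_def)
    ultimately have "(\<Sum>j\<in>{1..n+1}. y j) = 0"
      using sum.remove[OF _ i, of y] by (simp add: y_def)
    then have "(\<Sum>x\<in>X. y (inv_into {1..n+1} \<theta> x)) = 0"
      using sum.reindex_bij_betw[OF bij_betw_inv_into[OF \<theta>], of y] by simp
    moreover have "y (inv_into {1..n+1} \<theta> x) \<in> V x" if x: "x \<in> X" for x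
    proof -
      have "inv_into {1..n+1} \<theta> x \<in> {1..n+1}" "\<theta> (inv_into {1..n+1} \<theta> x) = x"
        using \<theta> x by (metis bij_betw_imp_surj_on inv_into_into, metis bij_betw_inv_into_right)
      moreover have "y j \<in> V (\<theta> j)" if "j \<in> {1..n+1}" for j
        using yi z that V[OF \<theta>X[OF i]] by (auto simp: y_def vec.subspace_neg)
      ultimately show ?thesis by metis
    qed
    ultimately have "y (inv_into {1..n+1} \<theta> (\<theta> i)) = 0"
      using indep[of "\<lambda>x. y (inv_into {1..n+1} \<theta> x)"] \<theta>X[OF i] by blast
    then have "yi = 0"
      using i \<theta> by (simp add: y_def bij_betw_inv_into_left)
    then show "p \<in> {0}"
      using yi L0 by simp
  next
    fix p :: "('r, 'k) divpow" assume "p \<in> {0}"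
    then show "p \<in> derivs (d - 1) (g i) \<inter>
      {(\<Sum>j\<in>{1..n+1} - {i}. h j) | h. \<forall>j\<in>{1..n+1} - {i}. h j \<in> derivs (d - 1) (g j)}"
      using zero_derivs by (auto intro!: exI[of _ "\<lambda>_. 0"])
  qed
  moreover have "g i \<in> forms d \<and> g i \<noteq> 0" if i: "i \<in> {1..n+1}" for i
  proof -
    obtain M where "size M = d" "G (\<theta> i) M \<noteq> 0"
      using nz \<theta>X[OF i] by blast
    then have "Poly_Mapping.lookup (g i) (expo M) \<noteq> 0"
      by (simp add: g_def)
    then have "g i \<noteq> 0"
      by (metis lookup_zero)
    then show ?thesis
      by (simp add: g_def form_of_in_forms)
  qed
  moreover have "form_of d (\<lambda>M. \<Sum>x\<in>X. G x M) = (\<Sum>i\<in>{1..n+1}. g i)"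
  proof (rule poly_mapping_eqI)
    fix \<alpha>
    have "(\<Sum>x\<in>X. G x (mset_of \<alpha>)) = (\<Sum>i\<in>{1..n+1}. G (\<theta> i) (mset_of \<alpha>))"
      by (rule sum.reindex_bij_betw[OF \<theta>, symmetric])
    then show "Poly_Mapping.lookup (form_of d (\<lambda>M. \<Sum>x\<in>X. G x M)) \<alpha> =
        Poly_Mapping.lookup (\<Sum>i\<in>{1..n+1}. g i) \<alpha>"
      by (simp add: lookup_sum g_def del: sum.cl_ivl_Suc)
  qed
  ultimately show ?thesis
    unfolding splits_regularly_def by (intro exI[of _ g] conjI ballI) simp_all
qed

section \<open>Chain bases of nilpotent matrices\<close>

lemma (in vector_space) independent_family:
  assumes I: "finite I" and f: "\<And>c x. (\<Sum>x\<in>I. scale (c x) (f x)) = 0 \<Longrightarrow> x \<in> I \<Longrightarrow> c x = 0"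
  shows "inj_on f I" "independent (f ` I)"
proof -
  show inj: "inj_on f I"
  proof (rule inj_onI, rule ccontr)
    fix x y assume xy: "x \<in> I" "y \<in> I" "f x = f y" "x \<noteq> y"
    have "(\<Sum>e\<in>I. scale (if e = x then 1 else if e = y then - 1 else 0) (f e)) =
        (\<Sum>e\<in>{x, y}. scale (if e = x then 1 else if e = y then - 1 else 0) (f e))"
      using xy I by (intro sum.mono_neutral_right) auto
    also have "\<dots> = 0"
      using xy by auto
    finally have "(\<Sum>e\<in>I. scale (if e = x then 1 else if e = y then - 1 else 0) (f e)) = 0" .
    from f[OF this xy(1)] show False
      by simp
  qed
  show "independent (f ` I)"
  proof (rule independent_if_scalars_zero)
    fix c x assume "(\<Sum>x\<in>f ` I. scale (c x) x) = 0" "x \<in> f ` I"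
    then show "c x = 0"
      using f[of "\<lambda>e. c (f e)"] by (auto simp: sum.reindex[OF inj])
  qed (use I in auto)
qed

text \<open>
  The Jordan form of a nilpotent operator, as a basis of chains \<open>e, N e, N\<^sup>2 e, \<dots>\<close>. Induction on
  the exponent that kills \<open>V\<close>: the image \<open>N V\<close> has a chain basis by induction, each of its chains
  is prolonged by a preimage of its head, and the last vectors of the chains, which are independent
  in the kernel of \<open>N\<close>, are completed to a basis of this kernel by chains of length one.
\<close>
lemma (in finite_dimensional_vector_space) nilpotent_chain_basis:
  assumes N: "Vector_Spaces.linear scale scale N"
    and "subspace V" "N ` V \<subseteq> V" "\<And>v. v \<in> V \<Longrightarrow> (N ^^ k) v = 0"
  shows "\<exists>S len. finite S \<and> S \<subseteq> V \<and> (\<forall>e\<in>S. 1 \<le> len e \<and> (N ^^ len e) e = 0) \<and>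
    (\<forall>c. (\<Sum>e\<in>S. \<Sum>i<len e. scale (c e i) ((N ^^ i) e)) = 0 \<longrightarrow> (\<forall>e\<in>S. \<forall>i<len e. c e i = 0)) \<and>
    (\<forall>v\<in>V. \<exists>c. v = (\<Sum>e\<in>S. \<Sum>i<len e. scale (c e i) ((N ^^ i) e)))"
  using assms(2-)
proof (induction k arbitrary: V)
  case 0
  then have "V = {0}"
    using subspace_0 by auto
  then show ?case
    by (intro exI[of _ "{}"]) auto
next
  case (Suc k)
  interpret N: Vector_Spaces.linear scale scale N
    by (rule N)
  have V: "subspace V" and NV: "\<And>v. v \<in> V \<Longrightarrow> N v \<in> V"
    using Suc.prems by auto
  have NiV: "(N ^^ i) v \<in> V" if "v \<in> V" for i v
    by (induction i) (use that NV in auto)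
  have "subspace (N ` V)"
    using V by (rule N.subspace_image)
  moreover have "N ` N ` V \<subseteq> N ` V"
    using NV by auto
  moreover have "(N ^^ k) v = 0" if "v \<in> N ` V" for v
    using that Suc.prems(3) by (auto simp: funpow_swap1)
  ultimately obtain S len where IH: "finite S \<and> S \<subseteq> N ` V \<and> (\<forall>e\<in>S. 1 \<le> len e \<and> (N ^^ len e) e = 0) \<and>
      (\<forall>c. (\<Sum>e\<in>S. \<Sum>i<len e. scale (c e i) ((N ^^ i) e)) = 0 \<longrightarrow> (\<forall>e\<in>S. \<forall>i<len e. c e i = 0)) \<and>
      (\<forall>v\<in>N ` V. \<exists>c. v = (\<Sum>e\<in>S. \<Sum>i<len e. scale (c e i) ((N ^^ i) e)))"
    using Suc.IH[of "N ` V"] by blast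
  then have S: "finite S" "S \<subseteq> N ` V" and len: "\<And>e. e \<in> S \<Longrightarrow> 1 \<le> len e \<and> (N ^^ len e) e = 0"
    by simp_all
  have indep: "c e i = 0"
    if "(\<Sum>e\<in>S. \<Sum>i<len e. scale (c e i) ((N ^^ i) e)) = 0" "e \<in> S" "i < len e" for c e i
    using IH that by blast
  have span: "\<exists>c. v = (\<Sum>e\<in>S. \<Sum>i<len e. scale (c e i) ((N ^^ i) e))" if "v \<in> N ` V" for v
    using IH that by blast
  have "\<forall>e\<in>S. \<exists>v\<in>V. N v = e"
    using S by auto
  then obtain p where p: "\<And>e. e \<in> S \<Longrightarrow> p e \<in> V" "\<And>e. e \<in> S \<Longrightarrow> N (p e) = e"
    by metis
  define z where "z e = (N ^^ len e) (p e)" for e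
  have zK: "z e \<in> V" "N (z e) = 0" if "e \<in> S" for e
    using that p len NiV by (auto simp: z_def funpow_swap1)
  have z_eq: "z e = (N ^^ (len e - 1)) e" if e: "e \<in> S" for e
  proof -
    obtain l where "len e = Suc l"
      using len[OF e] by (cases "len e") auto
    then show ?thesis
      using p(2)[OF e] by (simp add: z_def funpow_swap1)
  qed
  have z_indep: "c e = 0" if c: "(\<Sum>e\<in>S. scale (c e) (z e)) = 0" and e: "e \<in> S" for c e
  proof -
    have "(\<Sum>i<len e. scale (if i = len e - 1 then c e else 0) ((N ^^ i) e)) = scale (c e) (z e)"
      if "e \<in> S" for e
    proof -
      have "(\<Sum>i<len e. scale (if i = len e - 1 then c e else 0) ((N ^^ i) e)) =
          (\<Sum>i<len e. if i = len e - 1 then scale (c e) ((N ^^ i) e) else 0)"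
        by (intro sum.cong) auto
      also have "\<dots> = scale (c e) (z e)"
        using len[OF that] by (simp add: z_eq that)
      finally show ?thesis .
    qed
    then have "(\<Sum>e\<in>S. \<Sum>i<len e. scale (if i = len e - 1 then c e else 0) ((N ^^ i) e)) = 0"
      using c by simp
    from indep[OF this e, of "len e - 1"] show ?thesis
      using len[OF e] by simp
  qed
  have e_nz: "e \<noteq> 0" if "e \<in> S" for e
  proof
    assume "e = 0"
    have "(N ^^ i) 0 = 0" for i
      by (induction i) auto
    then have "(\<Sum>e'\<in>S. \<Sum>i<len e'. scale (if e' = e then 1 else 0) ((N ^^ i) e')) = 0"
      using \<open>e = 0\<close> by (intro sum.neutral ballI) auto
    from indep[OF this that, of 0] show False
      using len[OF that] by simp
  qed
  have z_inj: "inj_on z S" and z_ind: "independent (z ` S)"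
    using independent_family[OF S(1), of z] z_indep by blast+
  define K where "K = {v \<in> V. N v = 0}"
  obtain B where B: "z ` S \<subseteq> B" "B \<subseteq> K" "independent B" "K \<subseteq> span B"
    using maximal_independent_subset_extend[of "z ` S" K] z_ind zK
    by (auto simp: K_def)
  have finB: "finite B"
    using B(3) by (rule finiteI_independent)
  define T where "T = B - z ` S"
  define len' where "len' e = (if N e = 0 then 1 else Suc (len (N e)))" for e
  have disj: "p ` S \<inter> T = {}" and lenp: "\<And>e. e \<in> S \<Longrightarrow> len' (p e) = Suc (len e)"
    and lenT: "\<And>t. t \<in> T \<Longrightarrow> len' t = 1"
    using p e_nz B(2) by (auto simp: T_def K_def len'_def)
  have p_inj: "inj_on p S"
    by (rule inj_onI) (metis p(2))
  have sum_eq: "(\<Sum>e\<in>p ` S \<union> T. \<Sum>i<len' e. scale (c e i) ((N ^^ i) e)) =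
      (\<Sum>e\<in>S. \<Sum>i<len e. scale (c (p e) i) ((N ^^ i) (p e))) +
      ((\<Sum>e\<in>S. scale (c (p e) (len e)) (z e)) + (\<Sum>t\<in>T. scale (c t 0) t))" for c
  proof -
    have "(\<Sum>e\<in>p ` S \<union> T. \<Sum>i<len' e. scale (c e i) ((N ^^ i) e)) =
        (\<Sum>e\<in>S. \<Sum>i<len' (p e). scale (c (p e) i) ((N ^^ i) (p e))) +
        (\<Sum>t\<in>T. \<Sum>i<len' t. scale (c t i) ((N ^^ i) t))"
      using S finB disj by (subst sum.union_disjoint) (auto simp: T_def sum.reindex[OF p_inj])
    then show ?thesis
      by (simp add: lenp lenT sum.distrib z_def add.assoc)
  qed
  have B_sum: "(\<Sum>e\<in>S. scale (r (z e)) (z e)) + (\<Sum>t\<in>T. scale (r t) t) = (\<Sum>b\<in>B. scale (r b) b)" for r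
    using sum.subset_diff[OF B(1) finB, of "\<lambda>b. scale (r b) b"]
    by (simp add: T_def sum.reindex[OF z_inj] add.commute)
  show ?case
  proof (rule exI[of _ "p ` S \<union> T"], rule exI[of _ len'], intro conjI allI ballI impI)
    show "finite (p ` S \<union> T)"
      using S finB by (simp add: T_def)
    show "p ` S \<union> T \<subseteq> V"
      using p B by (auto simp: T_def K_def)
    fix e assume e: "e \<in> p ` S \<union> T"
    show "1 \<le> len' e"
      by (simp add: len'_def)
    show "(N ^^ len' e) e = 0"
    proof (cases "e \<in> T")
      case True
      then show ?thesis using B by (auto simp: lenT T_def K_def)
    next
      case False
      with e obtain e' where "e' \<in> S" "e = p e'" by auto
      then show ?thesis using zK by (simp add: lenp z_def)
    qed
  next
    fix c e i
    assume 0: "(\<Sum>e\<in>p ` S \<union> T. \<Sum>i<len' e. scale (c e i) ((N ^^ i) e)) = 0"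
      and e: "e \<in> p ` S \<union> T" and i: "i < len' e"
    have NT: "N t = 0" if "t \<in> T" for t
      using that B by (auto simp: T_def K_def)
    have "0 = N (\<Sum>e\<in>p ` S \<union> T. \<Sum>i<len' e. scale (c e i) ((N ^^ i) e))"
      by (simp add: 0)
    also have "\<dots> = (\<Sum>e\<in>S. \<Sum>i<len e. scale (c (p e) i) ((N ^^ i) e))"
      by (simp add: sum_eq N.add N.sum N.scale zK NT funpow_swap1 p)
    finally have c0: "c (p e) i = 0" if "e \<in> S" "i < len e" for e i
      using indep[of "\<lambda>e. c (p e)"] that by simp
    define r where "r b = (if b \<in> T then c b 0 else c (p (inv_into S z b)) (len (inv_into S z b)))" for b
    have r: "r (z e) = c (p e) (len e)" if "e \<in> S" for e
      using that by (simp add: r_def T_def inv_into_f_f[OF z_inj])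
    have rT: "r t = c t 0" if "t \<in> T" for t
      using that by (simp add: r_def)
    have "(\<Sum>b\<in>B. scale (r b) b) = 0"
      using 0 unfolding sum_eq B_sum[symmetric] by (simp add: c0 r rT)
    then have r0: "r b = 0" if "b \<in> B" for b
      using independentD[OF B(3) finB order_refl] that by blast
    show "c e i = 0"
    proof (cases "e \<in> T")
      case True
      then show ?thesis
        using r0[of e] i by (simp add: r_def lenT) (simp add: T_def)
    next
      case False
      with e obtain e' where e': "e' \<in> S" "e = p e'" by auto
      then have "i < len e' \<or> i = len e'"
        using i by (auto simp: lenp)
      moreover have "c (p e') (len e') = 0"
        using r0[of "z e'"] r[of e'] e' B(1) by auto
      ultimately show ?thesis
        using e' c0 by auto
    qed
  next
    fix v assume v: "v \<in> V"
    then obtain c where c: "N v = (\<Sum>e\<in>S. \<Sum>i<len e. scale (c e i) ((N ^^ i) e))"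
      using span by blast
    define w where "w = v - (\<Sum>e\<in>S. \<Sum>i<len e. scale (c e i) ((N ^^ i) (p e)))"
    have "w \<in> V"
      unfolding w_def
      by (intro subspace_diff[OF V] v subspace_sum[OF V] subspace_scale[OF V] NiV p)
    moreover have "N w = 0"
      by (simp add: w_def c N.diff N.sum N.scale funpow_swap1 p)
    ultimately have "w \<in> span B"
      using B(4) by (auto simp: K_def)
    then obtain r where r: "w = (\<Sum>b\<in>B. scale (r b) b)"
      using span_finite[OF finB] by auto
    define c' where "c' e i = (if e \<in> T then r e else if i < len (N e) then c (N e) i else r (z (N e)))" for e i
    have c': "c' (p e) i = (if i < len e then c e i else r (z e))" if "e \<in> S" for e i
      using that disj p by (auto simp: c'_def)
    have c'T: "c' t i = r t" if "t \<in> T" for t i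
      using that by (simp add: c'_def)
    have "v = (\<Sum>e\<in>p ` S \<union> T. \<Sum>i<len' e. scale (c' e i) ((N ^^ i) e))"
    proof -
      have "v = (\<Sum>e\<in>S. \<Sum>i<len e. scale (c e i) ((N ^^ i) (p e))) + w"
        by (simp add: w_def)
      then show ?thesis
        unfolding sum_eq r B_sum[symmetric] by (simp add: c' c'T)
    qed
    then show "\<exists>c'. v = (\<Sum>e\<in>p ` S \<union> T. \<Sum>i<len' e. scale (c' e i) ((N ^^ i) e))"
      by blast
  qed
qed

lemma funpow_vector_matrix: "((\<lambda>v. v v* A) ^^ k) v = v v* matpow A k"
proof (induction k arbitrary: v)
  case (Suc k)
  have "((\<lambda>v. v v* A) ^^ Suc k) v = (v v* A) v* matpow A k"
    by (simp only: funpow_Suc_right o_apply Suc.IH)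
  then show ?case
    by (simp add: matpow_def vector_matrix_mul_assoc)
qed (simp add: matpow_def)

lemma vector_matrix_sum: "v v* (\<Sum>m\<in>S. E m) = (\<Sum>m\<in>S. v v* E m)"
  by (induction S rule: infinite_finite_induct) (simp_all add: vector_matrix_mult_add_rdistrib)

lemma sum_vector_matrix: "(\<Sum>m\<in>S. f m) v* E = (\<Sum>m\<in>S. f m v* E)"
  by (induction S rule: infinite_finite_induct) (simp_all add: vector_matrix_left_distrib)

lemma linear_vector_matrix: "Vector_Spaces.linear (*s) (*s) (\<lambda>v. v v* (A :: 'k::field ^ 'r ^ 'r))"
  by unfold_locales (simp_all add: vector_matrix_left_distrib scalar_vector_matrix_assoc)

lemma axis_vector_matrix: "axis i 1 v* A = A $ i" for A :: "'k::field ^ 'r::finite ^ 'r"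
  by (simp add: vec_eq_iff vector_matrix_mult_def axis_def if_distrib[of "\<lambda>x. x * _"] cong: if_cong)

text \<open>
  The rows of \<open>b\<close> form a basis of chains; the row with index \<open>i\<close> is the vector of depth \<open>dep i\<close> in
  the chain with head \<open>hd i\<close>, in the block \<open>blk i\<close>. Indexing the basis by \<open>'r\<close> itself lets
  it serve as a change of coordinates of forms. Chains are complete (\<open>fill\<close>), and each
  block contains a chain that is not killed earlier than the whole matrix (\<open>long\<close>).
\<close>
locale chain_basis =
  fixes Bl :: "nat set" and A E :: "nat \<Rightarrow> 'k::field ^ 'r::finite ^ 'r"
    and b :: "'k ^ 'r ^ 'r" and blk dep :: "'r \<Rightarrow> nat" and hd :: "'r \<Rightarrow> 'k ^ 'r"
    and len :: "nat \<Rightarrow> 'k ^ 'r \<Rightarrow> nat"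
  assumes inv_b: "invertible b"
    and blk: "\<And>i. blk i \<in> Bl"
    and b: "\<And>i. b $ i = hd i v* matpow (A (blk i)) (dep i)"
    and hd: "\<And>i. hd i v* E (blk i) = hd i"
    and dep: "\<And>i. dep i < len (blk i) (hd i)"
    and len: "\<And>i. hd i v* matpow (A (blk i)) (len (blk i) (hd i)) = 0"
    and fill: "\<And>i k. k < len (blk i) (hd i) \<Longrightarrow> \<exists>i'. blk i' = blk i \<and> hd i' = hd i \<and> dep i' = k"
    and long: "\<And>m k. m \<in> Bl \<Longrightarrow> 1 \<le> k \<Longrightarrow> matpow (A m) k \<noteq> 0 \<Longrightarrow> \<exists>i. blk i = m \<and> k < len m (hd i)"

text \<open>
  The idempotents decompose the space of row vectors into the ranges of the \<open>E m\<close>, which are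
  stable under the \<open>A m\<close>; the union of chain bases of these ranges is a basis.
\<close>
lemma joint_chain_basis:
  fixes A E :: "nat \<Rightarrow> 'k::field ^ 'r::finite ^ 'r"
  assumes Bl: "finite Bl"
    and idem: "\<And>m. m \<in> Bl \<Longrightarrow> E m ** E m = E m"
    and orth: "\<And>m m'. m \<in> Bl \<Longrightarrow> m' \<in> Bl \<Longrightarrow> m \<noteq> m' \<Longrightarrow> E m ** E m' = 0"
    and total: "(\<Sum>m\<in>Bl. E m) = mat 1"
    and EA: "\<And>m. m \<in> Bl \<Longrightarrow> E m ** A m = A m" "\<And>m. m \<in> Bl \<Longrightarrow> A m ** E m = A m"
    and nilp: "\<And>m. m \<in> Bl \<Longrightarrow> matpow (A m) (n m) = 0"
  shows "\<exists>b blk dep hd len. chain_basis Bl A E b blk dep hd len"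
proof -
  define V where "V m = {v. v v* E m = v}" for m
  define P where "P m S len \<longleftrightarrow> finite S \<and> S \<subseteq> V m \<and>
    (\<forall>e\<in>S. 1 \<le> len e \<and> e v* matpow (A m) (len e) = 0) \<and>
    (\<forall>c. (\<Sum>e\<in>S. \<Sum>i<len e. c e i *s (e v* matpow (A m) i)) = 0 \<longrightarrow> (\<forall>e\<in>S. \<forall>i<len e. c e i = 0)) \<and>
    (\<forall>v\<in>V m. \<exists>c. v = (\<Sum>e\<in>S. \<Sum>i<len e. c e i *s (e v* matpow (A m) i)))" for m S len
  have "\<exists>S len. P m S len" if m: "m \<in> Bl" for m
  proof -
    have "vec.subspace (V m)"
      by (auto simp: vec.subspace_def V_def vector_matrix_left_distrib scalar_vector_matrix_assoc)
    moreover have "(\<lambda>v. v v* A m) ` V m \<subseteq> V m"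
      using m by (auto simp: V_def vector_matrix_mul_assoc EA)
    ultimately show ?thesis
      using vec.nilpotent_chain_basis[OF linear_vector_matrix, of "V m" "A m" "n m"] nilp[OF m]
      by (simp add: funpow_vector_matrix P_def)
  qed
  then obtain S len where "\<And>m. m \<in> Bl \<Longrightarrow> P m (S m) (len m)"
    by metis
  note Sl = this[unfolded P_def]
  have S: "finite (S m)" "S m \<subseteq> V m" if "m \<in> Bl" for m
    using Sl that by simp_all
  have len: "1 \<le> len m e" "e v* matpow (A m) (len m e) = 0" if "m \<in> Bl" "e \<in> S m" for m e
    using Sl that by simp_all
  have indep: "c e i = 0"
    if "m \<in> Bl" "(\<Sum>e\<in>S m. \<Sum>i<len m e. c e i *s (e v* matpow (A m) i)) = 0" "e \<in> S m" "i < len m e" for m c e i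
    using Sl that by blast
  have span: "\<exists>c. v = (\<Sum>e\<in>S m. \<Sum>i<len m e. c e i *s (e v* matpow (A m) i))" if "m \<in> Bl" "v \<in> V m" for m v
    using Sl that by blast
  define I where "I = (SIGMA m:Bl. SIGMA e:S m. {..<len m e})"
  define vc where "vc = (\<lambda>(m, e, i). e v* matpow (A m) i)"
  have finI: "finite I"
    using Bl S by (auto simp: I_def)
  have sum_I: "(\<Sum>x\<in>I. c x *s vc x) =
      (\<Sum>m\<in>Bl. \<Sum>e\<in>S m. \<Sum>i<len m e. c (m, e, i) *s (e v* matpow (A m) i))" for c
  proof -
    have "(\<Sum>m\<in>Bl. \<Sum>e\<in>S m. \<Sum>i<len m e. c (m, e, i) *s (e v* matpow (A m) i)) =
        (\<Sum>m\<in>Bl. \<Sum>y\<in>(SIGMA e:S m. {..<len m e}). c (m, y) *s vc (m, y))"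
      using S by (intro sum.cong refl, subst sum.Sigma) (auto simp: vc_def intro!: sum.cong)
    also have "\<dots> = (\<Sum>x\<in>I. c x *s vc x)"
      unfolding I_def using Bl S by (subst sum.Sigma) (auto intro!: sum.cong)
    finally show ?thesis ..
  qed
  have V: "vec.subspace (V m)" for m
    by (auto simp: vec.subspace_def V_def vector_matrix_left_distrib scalar_vector_matrix_assoc)
  have inV: "v v* matpow (A m) i \<in> V m" if "v \<in> V m" "m \<in> Bl" for v m i
    using that(1)
  proof (induction i arbitrary: v)
    case (Suc i)
    have "v v* A m \<in> V m"
      using that(2) by (simp add: V_def vector_matrix_mul_assoc EA)
    from Suc.IH[OF this] show ?case
      by (simp add: matpow_def vector_matrix_mul_assoc)
  qed (simp add: matpow_def)
  have I_indep: "c x = 0" if c: "(\<Sum>x\<in>I. c x *s vc x) = 0" and x: "x \<in> I" for c x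
  proof -
    obtain m e i where x_eq: "x = (m, e, i)" and m: "m \<in> Bl" and e: "e \<in> S m" "i < len m e"
      using x by (auto simp: I_def)
    define w where "w m = (\<Sum>e\<in>S m. \<Sum>i<len m e. c (m, e, i) *s (e v* matpow (A m) i))" for m
    have w: "w m \<in> V m" if "m \<in> Bl" for m
      unfolding w_def using S[OF that] that
      by (intro vec.subspace_sum[OF V] vec.subspace_scale[OF V] inV) auto
    have "w m' v* E m = (if m' = m then w m else 0)" if "m' \<in> Bl" for m'
    proof -
      have "w m' v* E m = w m' v* (E m' ** E m)"
        using w[OF that] by (simp add: V_def vector_matrix_mul_assoc[symmetric])
      then show ?thesis
        using orth[OF that m] idem[OF m] w[OF m] by (auto simp: V_def)
    qed
    then have "w m = (\<Sum>m'\<in>Bl. w m' v* E m)"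
      using m Bl by simp
    also have "\<dots> = (\<Sum>m'\<in>Bl. w m') v* E m"
      by (rule sum_vector_matrix[symmetric])
    also have "\<dots> = 0"
      using c by (simp add: sum_I w_def)
    finally show ?thesis
      using indep[OF m _ e, of "\<lambda>e i. c (m, e, i)"] by (simp add: w_def x_eq)
  qed
  have fam: "inj_on vc I" "vec.independent (vc ` I)"
    using vec.independent_family[OF finI, of vc] I_indep by blast+
  have "v \<in> vec.span (vc ` I)" for v
  proof -
    have "v v* E m \<in> vec.span (vc ` I)" if m: "m \<in> Bl" for m
    proof -
      have "v v* E m \<in> V m"
        by (simp add: V_def vector_matrix_mul_assoc idem[OF m])
      then obtain c where "v v* E m = (\<Sum>e\<in>S m. \<Sum>i<len m e. c e i *s (e v* matpow (A m) i))"
        using span[OF m] by blast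
      also have "\<dots> \<in> vec.span (vc ` I)"
      proof (intro vec.span_sum vec.span_scale vec.span_base)
        fix e i assume "e \<in> S m" "i \<in> {..<len m e}"
        then show "e v* matpow (A m) i \<in> vc ` I"
          using m by (intro image_eqI[of _ _ "(m, e, i)"]) (auto simp: I_def vc_def)
      qed
      finally show ?thesis .
    qed
    then have "(\<Sum>m\<in>Bl. v v* E m) \<in> vec.span (vc ` I)"
      by (rule vec.span_sum)
    then show ?thesis
      by (simp add: vector_matrix_sum[symmetric] total)
  qed
  then have "vec.span (vc ` I) = UNIV"
    by blast
  then have "card I = CARD('r)"
    using vec.dim_eq_card[of "vc ` I" UNIV] fam by (simp add: card_image card_cart_basis)
  then obtain \<theta> :: "'r \<Rightarrow> nat \<times> ('k ^ 'r) \<times> nat" where \<theta>: "bij_betw \<theta> UNIV I"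
    using finite_same_card_bij[of "UNIV :: 'r set" I] finI by auto
  have \<theta>I: "\<theta> i \<in> I" for i
    using \<theta> bij_betwE by blast
  have ex: "\<exists>i'. \<theta> i' = x" if "x \<in> I" for x
    using \<theta> that by (metis UNIV_I bij_betw_imp_surj_on imageE)
  define b where "b = (\<chi> i. vc (\<theta> i))"
  have "invertible b"
    unfolding invertible_right_inverse matrix_right_invertible_independent_rows
  proof (intro allI impI)
    fix c i assume "(\<Sum>i\<in>UNIV. c i *s row i b) = 0"
    moreover have "row i b = vc (\<theta> i)" for i
      by (simp add: row_def b_def vec_eq_iff)
    ultimately have "(\<Sum>i\<in>UNIV. (\<lambda>x. c (inv_into UNIV \<theta> x) *s vc x) (\<theta> i)) = 0"
      using \<theta> by (simp add: bij_betw_inv_into_left)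
    then have "(\<Sum>x\<in>I. c (inv_into UNIV \<theta> x) *s vc x) = 0"
      using sum.reindex_bij_betw[OF \<theta>, of "\<lambda>x. c (inv_into UNIV \<theta> x) *s vc x"] by simp
    from I_indep[OF this \<theta>I[of i]] show "c i = 0"
      using \<theta> by (simp add: bij_betw_inv_into_left)
  qed
  have "chain_basis Bl A E b (\<lambda>i. fst (\<theta> i)) (\<lambda>i. snd (snd (\<theta> i))) (\<lambda>i. fst (snd (\<theta> i))) len"
  proof (rule chain_basis.intro)
    fix i
    obtain m e k where \<theta>i: "\<theta> i = (m, e, k)"
      by (cases "\<theta> i") auto
    then have mek: "m \<in> Bl" "e \<in> S m" "k < len m e"
      using \<theta>I[of i] by (auto simp: I_def)
    show "fst (\<theta> i) \<in> Bl"
      "b $ i = fst (snd (\<theta> i)) v* matpow (A (fst (\<theta> i))) (snd (snd (\<theta> i)))"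
      "fst (snd (\<theta> i)) v* E (fst (\<theta> i)) = fst (snd (\<theta> i))"
      "snd (snd (\<theta> i)) < len (fst (\<theta> i)) (fst (snd (\<theta> i)))"
      "fst (snd (\<theta> i)) v* matpow (A (fst (\<theta> i))) (len (fst (\<theta> i)) (fst (snd (\<theta> i)))) = 0"
      using mek S(2) len by (auto simp: \<theta>i b_def vc_def V_def)
    fix l assume "l < len (fst (\<theta> i)) (fst (snd (\<theta> i)))"
    then have "(m, e, l) \<in> I"
      using mek by (auto simp: \<theta>i I_def)
    from ex[OF this] show "\<exists>i'. fst (\<theta> i') = fst (\<theta> i) \<and> fst (snd (\<theta> i')) = fst (snd (\<theta> i)) \<and> snd (snd (\<theta> i')) = l"
      by (metis \<theta>i fst_conv snd_conv)
  next
    fix m k assume m: "m \<in> Bl" and k1: "1 \<le> k" and k: "matpow (A m) k \<noteq> 0"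
    show "\<exists>i. fst (\<theta> i) = m \<and> k < len m (fst (snd (\<theta> i)))"
    proof (rule ccontr)
      assume neg: "\<not> ?thesis"
      have short: "len m e \<le> k" if "e \<in> S m" for e
      proof -
        have "(m, e, 0) \<in> I"
          using m that len[OF m that] by (auto simp: I_def)
        from ex[OF this] obtain i where "\<theta> i = (m, e, 0)" ..
        then have "\<not> k < len m e"
          using neg by (metis fst_conv snd_conv)
        then show ?thesis
          by simp
      qed
      have kill: "e v* matpow (A m) l = 0" if "len m e \<le> l" "e \<in> S m" for e l
      proof -
        have "e v* matpow (A m) (len m e + j) = 0" for j
          using len(2)[OF m that(2)]
          by (induction j) (simp_all add: funpow_vector_matrix[symmetric])
        from this[of "l - len m e"] that(1) show ?thesis
          by simp
      qed
      have "v v* matpow (A m) k = 0" for v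
      proof -
        have "v v* E m \<in> V m"
          by (simp add: V_def vector_matrix_mul_assoc idem[OF m])
        then obtain c where c: "v v* E m = (\<Sum>e\<in>S m. \<Sum>i<len m e. c e i *s (e v* matpow (A m) i))"
          using span[OF m] by blast
        have "(v v* E m) v* matpow (A m) k = 0"
          unfolding c sum_vector_matrix scalar_vector_matrix_assoc
        proof (intro sum.neutral ballI)
          fix e i assume e: "e \<in> S m"
          have "(e v* matpow (A m) i) v* matpow (A m) k = e v* matpow (A m) (k + i)"
            by (simp add: funpow_vector_matrix[symmetric] funpow_add)
          also have "\<dots> = 0"
            using short[OF e] by (intro kill e) simp
          finally show "c e i *s ((e v* matpow (A m) i) v* matpow (A m) k) = 0"
            by simp
        qed
        moreover have "E m ** matpow (A m) k = matpow (A m) k"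
          using k1 by (cases k) (simp_all add: matpow_def matrix_mul_assoc EA[OF m])
        ultimately show ?thesis
          by (simp add: vector_matrix_mul_assoc)
      qed
      then have "matpow (A m) k $ i = 0" for i
        by (metis axis_vector_matrix)
      then have "matpow (A m) k = 0"
        by (simp add: vec_eq_iff)
      with k show False ..
    qed
  qed (fact \<open>invertible b\<close>)
  then show ?thesis
    by blast
qed

section \<open>The algebra of a form\<close>

text \<open>
  The minor with row indices \<open>i\<close> and \<open>j\<close> is \<open>\<partial>\<^sub>i (A\<partial>)\<^sub>j - \<partial>\<^sub>j (A\<partial>)\<^sub>i\<close>, and \<open>(A\<partial>)\<^sub>j\<close> is the
  operator of the row \<open>A $ j\<close>. That it kills \<open>f\<close> is the claim.
\<close>
lemma M_alg_ddir_axes: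
  fixes f :: "('r::finite, 'k::field) divpow"
  assumes "A \<in> M_alg f"
  defines "\<Phi> \<equiv> \<lambda>M. Poly_Mapping.lookup f (expo M)"
  shows "ddir (A $ j) \<Phi> (add_mset i M) = ddir (A $ i) \<Phi> (add_mset j M)"
proof -
  interpret module "(*) :: ('r, 'k) mpoly \<Rightarrow> _"
    by unfold_locales (simp_all add: algebra_simps)
  let ?v = "pconst_mat A *v pvec"
  define P where "P = (\<lambda>i j. \<Sum>c\<in>UNIV. Poly_Mapping.single (expo {#i, c#}) (A $ j $ c))"
  have v: "pvec $ i * ?v $ j = P i j" for i j
  proof -
    have "pvec $ i * ?v $ j =
        (\<Sum>c\<in>UNIV. Poly_Mapping.single (Poly_Mapping.single i 1 + Poly_Mapping.single c 1) (A $ j $ c))"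
      by (simp add: pvec_def pvar_def pconst_mat_def matrix_vector_mult_def sum_distrib_left mult_single)
    also have "\<dots> = P i j"
      unfolding P_def by (intro sum.cong) (simp_all add: expo_def add.commute)
    finally show ?thesis .
  qed
  have "P i j - P j i \<in> minors2 pvec ?v"
    unfolding minors2_def v[symmetric] by blast
  then have "P i j - P j i \<in> ideal_gen (minors2 pvec ?v)"
    unfolding ideal_gen_def by (rule span_base)
  then have act0: "act (P i j - P j i) f = 0"
    using assms(1) by (auto simp: M_alg_def ann_def)
  define S where "S = {\<alpha> :: 'r \<Rightarrow>\<^sub>0 nat. mdeg \<alpha> = 2}"
  have S: "finite S"
    unfolding S_def by (rule finite_mdeg)
  define L where "L = (\<lambda>p :: ('r, 'k) mpoly. \<Sum>\<beta>\<in>S. Poly_Mapping.lookup p \<beta> * Poly_Mapping.lookup f (\<beta> + expo M))"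
  have LP: "L (P i j) = ddir (A $ j) \<Phi> (add_mset i M)" for i j
  proof -
    have "L (P i j) = (\<Sum>\<beta>\<in>S. \<Sum>c\<in>UNIV. (if \<beta> = expo {#i, c#} then A $ j $ c * Poly_Mapping.lookup f (\<beta> + expo M) else 0))"
      by (auto simp: L_def P_def lookup_sum lookup_single when_def sum_distrib_right intro!: sum.cong)
    also have "\<dots> = (\<Sum>c\<in>UNIV. \<Sum>\<beta>\<in>S. (if \<beta> = expo {#i, c#} then A $ j $ c * Poly_Mapping.lookup f (\<beta> + expo M) else 0))"
      by (rule sum.swap)
    also have "\<dots> = (\<Sum>c\<in>UNIV. A $ j $ c * Poly_Mapping.lookup f (expo {#i, c#} + expo M))"
      using S by (simp add: S_def)
    also have "\<dots> = ddir (A $ j) \<Phi> (add_mset i M)"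
      by (simp add: ddir_def \<Phi>_def expo_def ac_simps)
    finally show ?thesis .
  qed
  have "Poly_Mapping.keys (P i j) \<subseteq> S" for i j
  proof
    fix \<beta> assume "\<beta> \<in> Poly_Mapping.keys (P i j)"
    then have "(\<Sum>c\<in>UNIV. Poly_Mapping.lookup (Poly_Mapping.single (expo {#i, c#}) (A $ j $ c)) \<beta>) \<noteq> 0"
      unfolding in_keys_iff P_def lookup_sum .
    then obtain c where "Poly_Mapping.lookup (Poly_Mapping.single (expo {#i, c#}) (A $ j $ c)) \<beta> \<noteq> 0"
      by (meson sum.not_neutral_contains_not_neutral)
    then show "\<beta> \<in> S"
      by (auto simp: S_def lookup_single when_def split: if_splits)
  qed
  then have "Poly_Mapping.keys (P i j - P j i) \<subseteq> S"
    using keys_diff[of "P i j" "P j i"] by blast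
  then have "L (P i j - P j i) = 0"
    unfolding L_def by (subst lookup_act[OF S, symmetric]) (simp_all add: act0)
  moreover have "L (P i j - P j i) = L (P i j) - L (P j i)"
    by (simp add: L_def lookup_minus left_diff_distrib sum_subtractf)
  ultimately show ?thesis
    by (simp add: LP)
qed

text \<open>
  Members of \<open>M\<^sub>f\<close> are self-adjoint for the multilinear functional of \<open>f\<close>: extend the identity for
  coordinate vectors bilinearly.
\<close>
lemma M_alg_ddir:
  fixes f :: "('r::finite, 'k::field) divpow"
  assumes "A \<in> M_alg f"
  defines "\<Phi> \<equiv> \<lambda>M. Poly_Mapping.lookup f (expo M)"
  shows "ddir (u v* A) (ddir v \<Phi>) = ddir u (ddir (v v* A) \<Phi>)"
proof
  fix M
  have "ddir (u v* A) (ddir v \<Phi>) M = (\<Sum>i\<in>UNIV. u $ i * ddir v (ddir (A $ i) \<Phi>) M)"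
    unfolding ddir_vector_matrix by (simp only: ddir_commute[of v])
  also have "\<dots> = (\<Sum>i\<in>UNIV. u $ i * (\<Sum>j\<in>UNIV. v $ j * ddir (A $ i) \<Phi> (add_mset j M)))"
    by (simp add: ddir_def)
  also have "\<dots> = (\<Sum>i\<in>UNIV. u $ i * (\<Sum>j\<in>UNIV. v $ j * ddir (A $ j) \<Phi> (add_mset i M)))"
    using M_alg_ddir_axes[OF assms(1)] by (simp add: \<Phi>_def)
  also have "\<dots> = ddir u (ddir (v v* A) \<Phi>) M"
    by (simp add: ddir_def[of u] ddir_vector_matrix)
  finally show "ddir (u v* A) (ddir v \<Phi>) M = ddir u (ddir (v v* A) \<Phi>) M" .
qed

section \<open>Sequences interpolated by powers\<close>

text \<open>
  Multiplying by \<open>T q - T s\<close> eliminates the node \<open>s\<close> at the cost of one equation. The shift \<open>a\<close> of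
  the exponents is harmless because the nodes are nonzero.
\<close>
lemma vandermonde_shifted:
  fixes T :: "'i \<Rightarrow> 'a::idom"
  assumes "finite Q" "inj_on T Q" "\<And>q. q \<in> Q \<Longrightarrow> T q \<noteq> 0"
    and "\<And>k. a \<le> k \<Longrightarrow> k < a + card Q \<Longrightarrow> (\<Sum>q\<in>Q. c q * T q ^ k) = 0"
  shows "\<forall>q\<in>Q. c q = 0"
  using assms
proof (induction Q arbitrary: c rule: finite_induct)
  case (insert s Q)
  have "(\<Sum>q\<in>Q. (c q * (T q - T s)) * T q ^ k) = 0" if "a \<le> k" "k < a + card Q" for k
  proof -
    have "(\<Sum>q\<in>Q. (c q * (T q - T s)) * T q ^ k) =
        (\<Sum>q\<in>insert s Q. c q * T q ^ Suc k) - T s * (\<Sum>q\<in>insert s Q. c q * T q ^ k)"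
      using insert.hyps by (simp add: sum_distrib_left sum_subtractf[symmetric] algebra_simps)
    also have "\<dots> = 0"
      using insert.prems(3)[of k] insert.prems(3)[of "Suc k"] that insert.hyps by simp
    finally show ?thesis .
  qed
  with insert.IH[of "\<lambda>q. c q * (T q - T s)"] insert.prems
  have "\<forall>q\<in>Q. c q * (T q - T s) = 0"
    by auto
  moreover have "T q \<noteq> T s" if "q \<in> Q" for q
    using insert.prems(1) insert.hyps that by (auto simp: inj_on_def)
  ultimately have Q: "\<forall>q\<in>Q. c q = 0"
    by auto
  with insert.prems(3)[of a] insert.hyps have "c s * T s ^ a = 0"
    by simp
  with Q insert.prems(2)[of s] show ?case
    by auto
qed simp

text \<open>
  The sequence \<open>u\<close> starts with \<open>\<phi>\<close>, and satisfies the linear recurrence with characteristic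
  polynomial \<open>\<Prod> (z - t\<^sub>q)\<close>; the point is that it stays in the ring, while its expansion in
  geometric sequences needs fractions. The induction is Newton's scheme: with the last node \<open>s\<close>, the
  sequence \<open>u (k + 1) - s * u k\<close> is of the same kind for the remaining nodes. The map \<open>\<epsilon>\<close> is the
  specialization that sends all nodes to zero, where the recurrence forces \<open>u\<close> to vanish
  after its initial values.
\<close>
lemma newton_interpolation:
  fixes t \<phi> :: "nat \<Rightarrow> 'a::idom" and \<epsilon> :: "'a \<Rightarrow> 'b::ab_group_add"
  assumes \<epsilon>_add: "\<And>x y. \<epsilon> (x + y) = \<epsilon> x + \<epsilon> y"
    and \<epsilon>_t: "\<And>q x. q \<in> {1..\<nu>} \<Longrightarrow> \<epsilon> (t q * x) = 0" and inj: "inj_on t {1..\<nu>}"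
  shows "\<exists>u w. (\<forall>k<\<nu>. u k = \<phi> k) \<and> (\<forall>k\<ge>\<nu>. \<epsilon> (u k) = 0) \<and>
    (\<forall>k. Fract (u k) 1 = (\<Sum>q\<in>{1..\<nu>}. w q * Fract (t q) 1 ^ k))"
  using \<epsilon>_t inj
proof (induction \<nu> arbitrary: \<phi>)
  case 0
  have "\<epsilon> 0 = 0"
    using \<epsilon>_add[of 0 0] by simp
  then show ?case
    by (intro exI[of _ "\<lambda>_. 0"]) (simp add: Zero_fract_def)
next
  case (Suc \<nu>)
  define s where "s = t (Suc \<nu>)"
  have "inj_on t {1..\<nu>}"
    by (rule inj_on_subset[OF Suc.prems(2)]) auto
  from Suc.IH[OF Suc.prems(1) this, of "\<lambda>k. \<phi> (Suc k) - s * \<phi> k"]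
  obtain u' w' where u': "\<And>k. k < \<nu> \<Longrightarrow> u' k = \<phi> (Suc k) - s * \<phi> k"
    and \<epsilon>u': "\<And>k. k \<ge> \<nu> \<Longrightarrow> \<epsilon> (u' k) = 0"
    and w': "\<And>k. Fract (u' k) 1 = (\<Sum>q\<in>{1..\<nu>}. w' q * Fract (t q) 1 ^ k)"
    by auto
  define u where "u = rec_nat (\<phi> 0) (\<lambda>k x. s * x + u' k)"
  have u: "u 0 = \<phi> 0" "\<And>k. u (Suc k) = s * u k + u' k"
    by (simp_all add: u_def)
  define S where "S = Fract s 1"
  define T where "T q = Fract (t q) 1" for q
  define w where "w q = (if q = Suc \<nu> then Fract (\<phi> 0) 1 - (\<Sum>q\<in>{1..\<nu>}. w' q / (T q - S))
    else w' q / (T q - S))" for q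
  have TS: "T q - S \<noteq> 0" if "q \<in> {1..\<nu>}" for q
  proof -
    have "t q \<noteq> s"
      using inj_onD[OF Suc.prems(2), of q "Suc \<nu>"] that by (auto simp: s_def)
    then have "T q \<noteq> S"
      by (simp add: T_def S_def eq_fract)
    then show ?thesis
      by simp
  qed
  have "u k = \<phi> k" if "k < Suc \<nu>" for k
    using that by (induction k) (auto simp: u u')
  moreover have "\<epsilon> (u k) = 0" if "k \<ge> Suc \<nu>" for k
    using that Suc.prems(1)[of "Suc \<nu>"] by (cases k) (auto simp: u \<epsilon>_add \<epsilon>u' s_def)
  moreover have "Fract (u k) 1 = (\<Sum>q\<in>{1..Suc \<nu>}. w q * T q ^ k)" for k
  proof (induction k)
    case 0
    show ?case by (simp add: u w_def)
  next
    case (Suc k)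
    have "(\<Sum>q\<in>{1..Suc \<nu>}. w q * T q ^ Suc k) - S * (\<Sum>q\<in>{1..Suc \<nu>}. w q * T q ^ k) =
        (\<Sum>q\<in>{1..Suc \<nu>}. w q * (T q - S) * T q ^ k)"
      by (simp add: sum_distrib_left sum_subtractf[symmetric] algebra_simps del: sum.cl_ivl_Suc)
    also have "\<dots> = (\<Sum>q\<in>{1..\<nu>}. w q * (T q - S) * T q ^ k)"
      by (simp add: S_def T_def s_def Zero_fract_def[symmetric])
    also have "\<dots> = (\<Sum>q\<in>{1..\<nu>}. w' q * T q ^ k)"
      using TS by (intro sum.cong) (auto simp: w_def)
    also have "\<dots> = Fract (u' k) 1"
      by (simp add: w' T_def)
    finally have "(\<Sum>q\<in>{1..Suc \<nu>}. w q * T q ^ Suc k) = S * Fract (u k) 1 + Fract (u' k) 1"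
      unfolding Suc.IH by (simp add: algebra_simps)
    also have "\<dots> = Fract (u (Suc k)) 1"
      by (simp add: S_def u)
    finally show ?case ..
  qed
  ultimately show ?case
    unfolding T_def by blast
qed

section \<open>Forms in chain coordinates\<close>

lemma vector_matpow_add: "(v v* matpow A j) v* matpow A k = v v* matpow A (j + k)"
  by (simp add: funpow_vector_matrix[symmetric] funpow_add add.commute[of j])

text \<open>
  A form \<open>\<Phi>\<close> together with a chain basis such that the powers of \<open>A m\<close> from \<open>a m\<close> on are
  self-adjoint for \<open>\<Phi>\<close>.
\<close>
locale chain_data = chain_basis Bl A E b blk dep hd len
  for Bl and A E :: "nat \<Rightarrow> 'k::field ^ 'r::finite ^ 'r" and b blk dep hd len +
  fixes a n :: "nat \<Rightarrow> nat" and \<Phi> :: "'r multiset \<Rightarrow> 'k"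
  assumes finite_Bl: "finite Bl"
    and orth: "\<And>m m'. m \<in> Bl \<Longrightarrow> m' \<in> Bl \<Longrightarrow> m \<noteq> m' \<Longrightarrow> E m ** E m' = 0"
    and EA: "\<And>m. m \<in> Bl \<Longrightarrow> E m ** A m = A m" "\<And>m. m \<in> Bl \<Longrightarrow> A m ** E m = A m"
    and nilp: "\<And>m. m \<in> Bl \<Longrightarrow> matpow (A m) (n m) = 0"
    and index: "\<And>m. m \<in> Bl \<Longrightarrow> a m < n m \<Longrightarrow> matpow (A m) (n m - 1) \<noteq> 0"
    and a: "\<And>m. m \<in> Bl \<Longrightarrow> 1 \<le> a m"
    and balanced: "\<And>m k u v. m \<in> Bl \<Longrightarrow> a m \<le> k \<Longrightarrow>
      ddir (u v* matpow (A m) k) (ddir v \<Phi>) = ddir u (ddir (v v* matpow (A m) k) \<Phi>)"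
begin

text \<open>
  A longer chain would contain a vector that is killed, but vectors of a basis are nonzero.
\<close>
lemma len_le: "len (blk i) (hd i) \<le> n (blk i)"
proof (rule ccontr)
  assume "\<not> len (blk i) (hd i) \<le> n (blk i)"
  then obtain i' where i': "blk i' = blk i" "hd i' = hd i" "dep i' = n (blk i)"
    using fill[of "n (blk i)" i] by auto
  then have "b $ i' = 0"
    by (simp add: b nilp[OF blk])
  moreover obtain C where "b ** C = mat 1"
    using inv_b by (auto simp: invertible_def)
  then have "b $ i' v* C = mat 1 $ i'"
    by (metis axis_vector_matrix vector_matrix_mul_assoc)
  ultimately have "(mat 1 :: 'k ^ 'r ^ 'r) $ i' $ i' = 0"
    by (metis vector_matrix_mult_0 zero_index)
  then show False
    by (simp add: mat_def)
qed

lemma basis_vector_idem: "b $ i v* E (blk i) = b $ i"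
proof (cases "dep i")
  case 0
  then show ?thesis
    by (simp add: b matpow_def hd)
next
  case (Suc k)
  have "b $ i = (hd i v* matpow (A (blk i)) k) v* A (blk i)"
    by (simp add: b Suc funpow_vector_matrix[symmetric])
  then show ?thesis
    by (metis EA(2)[OF blk] vector_matrix_mul_assoc)
qed

lemma basis_vector_other_block:
  assumes "m \<in> Bl" "m \<noteq> blk i" "1 \<le> k"
  shows "b $ i v* matpow (A m) k = 0"
proof -
  obtain l where k: "k = Suc l"
    using assms(3) by (cases k) auto
  have "b $ i v* A m = ((b $ i v* E (blk i)) v* E m) v* A m"
    using assms(1) by (simp add: basis_vector_idem vector_matrix_mul_assoc EA)
  also have "\<dots> = 0"
    using assms blk[of i] by (simp add: vector_matrix_mul_assoc[of _ "E (blk i)"] orth)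
  finally have "(b $ i v* A m) v* matpow (A m) l = 0"
    by simp
  then show ?thesis
    by (simp add: k matpow_def vector_matrix_mul_assoc)
qed

lemma mform_move:
  assumes "m \<in> Bl" "a m \<le> k"
  shows "mform \<Phi> (add_mset (u v* matpow (A m) k) (add_mset v us)) =
    mform \<Phi> (add_mset u (add_mset (v v* matpow (A m) k) us))"
proof -
  have "ddir v (ddir (u v* matpow (A m) k) \<Phi>) = ddir (v v* matpow (A m) k) (ddir u \<Phi>)"
    using balanced[OF assms, of v u] by (simp add: ddir_commute)
  then show ?thesis
    by simp
qed

text \<open>
  The power of \<open>A\<close> in the deep vector may be moved to the vector of the other block,
  which it kills.
\<close>
lemma pull_mixed:
  assumes "a (blk i) \<le> dep i" "blk j \<noteq> blk i"
  shows "pull b \<Phi> (add_mset i (add_mset j M)) = 0"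
proof -
  have "pull b \<Phi> (add_mset i (add_mset j M)) = mform \<Phi> (add_mset (hd i v* matpow (A (blk i)) (dep i))
      (add_mset (b $ j) (image_mset (\<lambda>i. b $ i) M)))"
    by (simp add: pull_def b)
  also have "\<dots> = mform \<Phi> (add_mset (hd i)
      (add_mset (b $ j v* matpow (A (blk i)) (dep i)) (image_mset (\<lambda>i. b $ i) M)))"
    by (rule mform_move[OF blk assms(1)])
  also have "b $ j v* matpow (A (blk i)) (dep i) = 0"
    using assms a[OF blk, of i] by (intro basis_vector_other_block blk) auto
  finally show ?thesis
    by simp
qed

text \<open>
  A power \<open>k \<ge> a m\<close> collects the depths of all other arguments: move it to the vector
  \<open>h'A\<^sup>l\<close>, where it becomes the power \<open>l + k\<close> of the head \<open>h'\<close>, and move that power back.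
\<close>
lemma mform_collect:
  assumes "m \<in> Bl" "a m \<le> k" "\<forall>i\<in>#M. blk i = m"
  shows "mform \<Phi> (add_mset (h v* matpow (A m) k) (image_mset (\<lambda>i. b $ i) M + us)) =
    mform \<Phi> (add_mset (h v* matpow (A m) (k + (\<Sum>i\<in>#M. dep i))) (image_mset hd M + us))"
  using assms(2,3)
proof (induction M arbitrary: k us)
  case (add i M)
  have "mform \<Phi> (add_mset (h v* matpow (A m) k) (image_mset (\<lambda>i. b $ i) (add_mset i M) + us)) =
      mform \<Phi> (add_mset (h v* matpow (A m) k)
        (add_mset (hd i v* matpow (A m) (dep i)) (image_mset (\<lambda>i. b $ i) M + us)))"
    using add.prems by (simp add: b)
  also have "\<dots> = mform \<Phi> (add_mset h
        (add_mset (hd i v* matpow (A m) (dep i + k)) (image_mset (\<lambda>i. b $ i) M + us)))"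
    using assms(1) add.prems by (simp only: mform_move vector_matpow_add)
  also have "\<dots> = mform \<Phi> (add_mset (h v* matpow (A m) (dep i + k))
        (add_mset (hd i) (image_mset (\<lambda>i. b $ i) M + us)))"
    using assms(1) add.prems by (intro mform_move[symmetric]) auto
  also have "\<dots> = mform \<Phi> (add_mset (h v* matpow (A m) (dep i + k))
        (image_mset (\<lambda>i. b $ i) M + add_mset (hd i) us))"
    by simp
  also have "\<dots> = mform \<Phi> (add_mset (h v* matpow (A m) (dep i + k + (\<Sum>i\<in>#M. dep i)))
        (image_mset hd M + add_mset (hd i) us))"
    using add.prems by (intro add.IH) auto
  finally show ?case
    by (simp add: ac_simps)
qed simp

text \<open>
  The value of the functional on the heads \<open>H\<close> with total depth \<open>k\<close>; by \<open>chain_value_eq\<close> it is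
  irrelevant for \<open>k \<ge> a m\<close> which head carries the depth.
\<close>
definition chain_value :: "nat \<Rightarrow> nat \<Rightarrow> ('k ^ 'r) multiset \<Rightarrow> 'k" where
  "chain_value m k H = (let h = SOME h. h \<in># H in
    mform \<Phi> (add_mset (h v* matpow (A m) k) (H - {#h#})))"

lemma chain_value_eq:
  assumes "m \<in> Bl" "a m \<le> k" "h \<in># H"
  shows "chain_value m k H = mform \<Phi> (add_mset (h v* matpow (A m) k) (H - {#h#}))"
proof -
  define h' where "h' = (SOME h. h \<in># H)"
  have h': "h' \<in># H"
    unfolding h'_def using assms(3) by (rule someI)
  have "mform \<Phi> (add_mset (h' v* matpow (A m) k) (H - {#h'#})) =
      mform \<Phi> (add_mset (h v* matpow (A m) k) (H - {#h#}))"
  proof (cases "h = h'")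
    case False
    then have "h \<in># H - {#h'#}"
      using assms(3) by (simp add: in_diff_count)
    then obtain H' where H: "H = add_mset h' (add_mset h H')"
      by (metis h' insert_DiffM)
    then show ?thesis
      using mform_move[OF assms(1,2), of h' h H'] by (simp add: add_mset_commute del: mform_add)
  qed simp
  then show ?thesis
    by (simp add: chain_value_def h'_def[symmetric] del: mform_add)
qed

lemma chain_value_eq_0:
  assumes "m \<in> Bl" "a m \<le> k" "h \<in># H" "h v* matpow (A m) l = 0" "l \<le> k"
  shows "chain_value m k H = 0"
proof -
  have "h v* matpow (A m) k = (h v* matpow (A m) l) v* matpow (A m) (k - l)"
    using assms(5) by (simp add: vector_matpow_add)
  then show ?thesis
    by (simp add: chain_value_eq[OF assms(1-3)] assms(4))
qed

lemma pull_deep: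
  assumes "i \<in># M" "a (blk i) \<le> dep i" "\<forall>j\<in>#M. blk j = blk i"
  shows "pull b \<Phi> M = chain_value (blk i) (\<Sum>j\<in>#M. dep j) (image_mset hd M)"
proof -
  obtain M' where M: "M = add_mset i M'"
    using assms(1) by (metis insert_DiffM)
  have "pull b \<Phi> M = mform \<Phi> (add_mset (hd i v* matpow (A (blk i)) (dep i)) (image_mset (\<lambda>i. b $ i) M' + {#}))"
    by (simp add: pull_def M b del: mform_add)
  also have "\<dots> = mform \<Phi> (add_mset (hd i v* matpow (A (blk i)) (dep i + (\<Sum>i\<in>#M'. dep i))) (image_mset hd M' + {#}))"
    using assms(3) by (intro mform_collect blk assms(2)) (simp add: M)
  also have "\<dots> = chain_value (blk i) (\<Sum>j\<in>#M. dep j) (image_mset hd M)"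
    using assms(2) by (subst chain_value_eq[OF blk, of _ _ "hd i"]) (simp_all add: M del: mform_add)
  finally show ?thesis .
qed

text \<open>
  The index \<open>Some (m, q)\<close> belongs to the root \<open>t\<^sub>q\<close> in block \<open>m\<close>, and \<open>None\<close> to the remainder of the
  deformed form.
\<close>
definition components :: "(nat \<times> nat) option set" where
  "components = insert None (Some ` (SIGMA m:Bl. {1..n m - a m}))"

lemma finite_components: "finite components"
  using finite_Bl by (simp add: components_def)

lemma card_components: "card components = (\<Sum>m\<in>Bl. n m - a m) + 1"
  using finite_Bl by (simp add: components_def card_image)

lemma sum_components: "(\<Sum>x\<in>components. f x) = f None + (\<Sum>m\<in>Bl. \<Sum>q\<in>{1..n m - a m}. f (Some (m, q)))"
  using finite_Bl by (simp add: components_def sum.reindex sum.Sigma comp_def split_def)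

text \<open>
  The linear forms that may occur as derivatives of a component, in chain coordinates. For
  \<open>Some (m, q)\<close> they vanish outside block \<open>m\<close> and are geometric with ratio \<open>T q\<close> along its chains; a
  chain of length \<open>l\<close> involves only the first \<open>l - a m\<close> roots.
\<close>
definition component_space :: "(nat \<Rightarrow> 'a::field) \<Rightarrow> (nat \<times> nat) option \<Rightarrow> ('a ^ 'r) set" where
  "component_space T x = (case x of
      None \<Rightarrow> {y. \<forall>i. a (blk i) \<le> dep i \<longrightarrow> y $ i = 0}
    | Some (m, q) \<Rightarrow> {y. \<exists>z. (\<forall>h. z h \<noteq> 0 \<longrightarrow> q + a m \<le> len m h) \<and>
        (\<forall>i. y $ i = (if blk i = m then z (hd i) * T q ^ dep i else 0))})"

lemma subspace_component_space: "vec.subspace (component_space T x)"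
proof (cases x)
  case None
  then show ?thesis
    by (auto simp: component_space_def vec.subspace_def)
next
  case (Some mq)
  obtain m q where mq: "mq = (m, q)"
    by (cases mq) auto
  show ?thesis
    unfolding vec.subspace_def
  proof (intro conjI ballI allI)
    show "0 \<in> component_space T x"
      by (auto simp: component_space_def Some mq intro!: exI[of _ "\<lambda>_. 0"])
    fix y1 assume "y1 \<in> component_space T x"
    then obtain z1 where z1: "\<forall>h. z1 h \<noteq> 0 \<longrightarrow> q + a m \<le> len m h"
      "\<forall>i. y1 $ i = (if blk i = m then z1 (hd i) * T q ^ dep i else 0)"
      by (auto simp: component_space_def Some mq)
    show "c *s y1 \<in> component_space T x" for c
      using z1 by (auto simp: component_space_def Some mq intro!: exI[of _ "\<lambda>h. c * z1 h"])
    fix y2 assume "y2 \<in> component_space T x"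
    then obtain z2 where z2: "\<forall>h. z2 h \<noteq> 0 \<longrightarrow> q + a m \<le> len m h"
      "\<forall>i. y2 $ i = (if blk i = m then z2 (hd i) * T q ^ dep i else 0)"
      by (auto simp: component_space_def Some mq)
    have "z1 h + z2 h \<noteq> 0 \<Longrightarrow> q + a m \<le> len m h" for h
      using z1(1) z2(1) by (metis add_0)
    then show "y1 + y2 \<in> component_space T x"
      using z1(2) z2(2)
      by (auto simp: component_space_def Some mq distrib_right intro!: exI[of _ "\<lambda>h. z1 h + z2 h"])
  qed
qed

text \<open>
  Read the relation along one chain, at the depths from \<open>a m\<close> up to the length \<open>l\<close> of the chain. The
  remainder contributes nothing there, and the other components contribute geometric sequences
  with at most \<open>l - a m\<close> distinct ratios in as many equations.
\<close>
lemma component_spaces_independent: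
  fixes T :: "nat \<Rightarrow> 'a::field"
  assumes T: "inj_on T {1..}" "\<And>q. q \<ge> 1 \<Longrightarrow> T q \<noteq> 0"
    and y: "\<And>x. x \<in> components \<Longrightarrow> y x \<in> component_space T x" and sum: "(\<Sum>x\<in>components. y x) = 0"
  shows "\<forall>x\<in>components. y x = 0"
proof -
  have "\<forall>m\<in>Bl. \<forall>q\<in>{1..n m - a m}. \<exists>z. (\<forall>h. z h \<noteq> 0 \<longrightarrow> q + a m \<le> len m h) \<and>
      (\<forall>i. y (Some (m, q)) $ i = (if blk i = m then z (hd i) * T q ^ dep i else 0))"
  proof (intro ballI)
    fix m q assume "m \<in> Bl" "q \<in> {1..n m - a m}"
    then have "y (Some (m, q)) \<in> component_space T (Some (m, q))"
      by (intro y) (auto simp: components_def)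
    then show "\<exists>z. (\<forall>h. z h \<noteq> 0 \<longrightarrow> q + a m \<le> len m h) \<and>
      (\<forall>i. y (Some (m, q)) $ i = (if blk i = m then z (hd i) * T q ^ dep i else 0))"
      by (simp add: component_space_def)
  qed
  then obtain z where z: "\<And>m q h. m \<in> Bl \<Longrightarrow> q \<in> {1..n m - a m} \<Longrightarrow> z m q h \<noteq> 0 \<Longrightarrow> q + a m \<le> len m h"
    and yz: "\<And>m q i. m \<in> Bl \<Longrightarrow> q \<in> {1..n m - a m} \<Longrightarrow>
      y (Some (m, q)) $ i = (if blk i = m then z m q (hd i) * T q ^ dep i else 0)"
    by metis
  have rest: "y None $ i = 0" if "a (blk i) \<le> dep i" for i
    using y[of None] that by (simp add: components_def component_space_def)
  have z0: "z (blk i) q (hd i) = 0" if q: "q \<in> {1..n (blk i) - a (blk i)}" for i q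
  proof (rule ccontr)
    assume nz: "z (blk i) q (hd i) \<noteq> 0"
    define m where "m = blk i"
    define Q where "Q = {q \<in> {1..n m - a m}. q + a m \<le> len m (hd i)}"
    have "Q \<subseteq> {1..len m (hd i) - a m}"
      by (auto simp: Q_def)
    from card_mono[OF _ this] have card: "card Q \<le> len m (hd i) - a m"
      by simp
    have "\<forall>q\<in>Q. z m q (hd i) = 0"
    proof (rule vandermonde_shifted[where T = T and a = "a m"])
      show "finite Q"
        by (simp add: Q_def)
      show "inj_on T Q"
        by (rule inj_on_subset[OF T(1)]) (auto simp: Q_def)
      show "T q \<noteq> 0" if "q \<in> Q" for q
        using that by (intro T) (simp add: Q_def)
      fix k assume k: "a m \<le> k" "k < a m + card Q"
      then have "k < len m (hd i)"
        using card by simp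
      then obtain i' where i': "blk i' = m" "hd i' = hd i" "dep i' = k"
        using fill[of k i] by (auto simp: m_def)
      have "0 = (\<Sum>x\<in>components. y x) $ i'"
        by (simp add: sum)
      also have "\<dots> = (\<Sum>m'\<in>Bl. \<Sum>q\<in>{1..n m' - a m'}. y (Some (m', q)) $ i')"
        using rest[of i'] i' k by (simp add: sum_components)
      also have "\<dots> = (\<Sum>m'\<in>Bl. if m' = m then \<Sum>q\<in>{1..n m - a m}. z m q (hd i) * T q ^ k else 0)"
        by (intro sum.cong refl) (auto simp: yz i')
      also have "\<dots> = (\<Sum>q\<in>{1..n m - a m}. z m q (hd i) * T q ^ k)"
        using finite_Bl blk[of i] by (simp add: m_def)
      also have "\<dots> = (\<Sum>q\<in>Q. z m q (hd i) * T q ^ k)"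
        using z[of m _ "hd i"] blk[of i] by (intro sum.mono_neutral_right) (auto simp: Q_def m_def)
      finally show "(\<Sum>q\<in>Q. z m q (hd i) * T q ^ k) = 0" ..
    qed
    moreover have "q \<in> Q"
      using q z[OF blk q nz] by (simp add: Q_def m_def)
    ultimately show False
      using nz by (simp add: m_def)
  qed
  have Some0: "y (Some (m, q)) = 0" if "m \<in> Bl" "q \<in> {1..n m - a m}" for m q
    using that z0 by (auto simp: vec_eq_iff yz)
  then have "y None = 0"
    using sum by (simp add: sum_components)
  with Some0 show ?thesis
    by (auto simp: components_def)
qed

end

section \<open>The deformation\<close>

text \<open>
  The ring \<open>K[\<tau>]\<close> in abstract form: \<open>\<kappa>\<close> embeds the constants and \<open>\<epsilon>\<close> evaluates at \<open>\<tau> = 0\<close>.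
\<close>
locale deformation_parameter =
  fixes \<tau> :: "'a::idom" and \<epsilon> :: "'a \<Rightarrow> 'k::field" and \<kappa> :: "'k \<Rightarrow> 'a"
  assumes \<epsilon>_add: "\<And>x y. \<epsilon> (x + y) = \<epsilon> x + \<epsilon> y" and \<epsilon>_mult: "\<And>x y. \<epsilon> (x * y) = \<epsilon> x * \<epsilon> y"
    and \<kappa>_add: "\<And>x y. \<kappa> (x + y) = \<kappa> x + \<kappa> y" and \<kappa>_mult: "\<And>x y. \<kappa> (x * y) = \<kappa> x * \<kappa> y"
    and \<kappa>_1: "\<kappa> 1 = 1" and \<epsilon>_\<kappa>: "\<And>c. \<epsilon> (\<kappa> c) = c"
    and \<epsilon>_\<tau>: "\<epsilon> \<tau> = 0" and inj_\<tau>: "inj_on (\<lambda>q. \<tau> ^ q) {1::nat..}"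
begin

lemma \<kappa>_0 [simp]: "\<kappa> 0 = 0"
  by (metis \<kappa>_add add_cancel_right_right)

lemma \<epsilon>_0 [simp]: "\<epsilon> 0 = 0"
  by (metis \<epsilon>_add add_cancel_right_right)

lemma \<epsilon>_sum: "\<epsilon> (sum f S) = (\<Sum>x\<in>S. \<epsilon> (f x))"
  by (induction S rule: infinite_finite_induct) (simp_all add: \<epsilon>_add)

lemma \<kappa>_sum: "\<kappa> (sum f S) = (\<Sum>x\<in>S. \<kappa> (f x))"
  by (induction S rule: infinite_finite_induct) (simp_all add: \<kappa>_add)

lemma \<tau>_nonzero: "\<tau> \<noteq> 0"
proof
  assume "\<tau> = 0"
  then have "\<tau> ^ 1 = \<tau> ^ 2"
    by simp
  then have "(1::nat) = 2"
    by (rule inj_onD[OF inj_\<tau>]) auto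
  then show False
    by simp
qed

definition T :: "nat \<Rightarrow> 'a fract" where
  "T q = Fract (\<tau> ^ q) 1"

lemma T_nonzero: "T q \<noteq> 0"
  using \<tau>_nonzero by (simp add: T_def Zero_fract_def eq_fract)

lemma inj_T: "inj_on T {1..}"
  using inj_\<tau> by (auto simp: inj_on_def T_def eq_fract)

end

lemma Fract_add1: "Fract (x + y) 1 = Fract x 1 + Fract (y :: 'a::idom) 1"
  by simp

lemma Fract_mult1: "Fract (x * y) 1 = Fract x 1 * Fract (y :: 'a::idom) 1"
  by simp

lemma Fract_sum1: "Fract (sum f S) 1 = (\<Sum>x\<in>S. Fract (f x :: 'a::idom) 1)"
  by (induction S rule: infinite_finite_induct)
    (simp_all add: Zero_fract_def Fract_add1 del: add_fract)

lemma Fract_power1: "Fract (x ^ k) 1 = Fract (x :: 'a::idom) 1 ^ k"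
  by (induction k) (simp_all add: One_fract_def Fract_mult1 del: mult_fract)

lemma Fract_eq_0_iff1: "Fract x 1 = 0 \<longleftrightarrow> (x :: 'a::idom) = 0"
  by (simp add: Zero_fract_def eq_fract)

locale chain_deformation =
  chain_data Bl A E b blk dep hd len a n \<Phi> + deformation_parameter \<tau> \<epsilon> \<kappa>
  for Bl and A E :: "nat \<Rightarrow> 'k::field ^ 'r::finite ^ 'r" and b blk dep hd len a n \<Phi>
    and \<tau> :: "'a::idom" and \<epsilon> :: "'a \<Rightarrow> 'k" and \<kappa>
begin

text \<open>
  The deformed form in chain coordinates. On multisets of indices that lie in one block and contain an
  index of depth at least \<open>a\<close> (called deep) it is given by the interpolating sequences, and
  elsewhere it is the given form. It may happen that some of the components \<open>g\<close> are zero.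
\<close>
lemma deformed_form:
  obtains F :: "'r multiset \<Rightarrow> 'a" and g :: "(nat \<times> nat) option \<Rightarrow> 'r multiset \<Rightarrow> 'a fract"
  where "\<And>M. \<epsilon> (F M) = pull b \<Phi> M"
    and "\<And>M. Fract (F M) 1 = (\<Sum>x\<in>components. g x M)"
    and "\<And>x M. x \<in> components \<Longrightarrow> (\<chi> i. g x (add_mset i M)) \<in> component_space T x"
proof -
  \<comment> \<open>The number of roots: shortest chain length minus \<open>a m\<close>, and \<open>0\<close> if that is negative.\<close>
  define \<nu> where "\<nu> m H = Min (len m ` set_mset H) - a m" for m H
  \<comment> \<open>The sequence \<open>u\<close> is indexed by the total depth minus \<open>a m\<close>, for heads \<open>H\<close> in block \<open>m\<close>.\<close>
  define P where "P m H u w \<longleftrightarrow> (\<forall>k<\<nu> m H. u k = \<kappa> (chain_value m (a m + k) H)) \<and>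
      (\<forall>k\<ge>\<nu> m H. \<epsilon> (u k) = 0) \<and> (\<forall>k. Fract (u k) 1 = (\<Sum>q\<in>{1..\<nu> m H}. w q * T q ^ k))"
    for m H u w
  have "\<exists>u w. P m H u w" for m H
    unfolding P_def T_def
  proof (rule newton_interpolation[OF \<epsilon>_add])
    show "\<epsilon> (\<tau> ^ q * x) = 0" if "q \<in> {1..\<nu> m H}" for q x
      using that by (cases q) (simp_all add: \<epsilon>_mult \<epsilon>_\<tau>)
    show "inj_on (\<lambda>q. \<tau> ^ q) {1..\<nu> m H}"
      by (rule inj_on_subset[OF inj_\<tau>]) auto
  qed
  then obtain U W where "\<And>m H. P m H (U m H) (W m H)"
    by metis
  note UW = this[unfolded P_def]
  have U_low: "U m H k = \<kappa> (chain_value m (a m + k) H)" if "k < \<nu> m H" for m H k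
    using UW[of m H] that by blast
  have U_high: "\<epsilon> (U m H k) = 0" if "k \<ge> \<nu> m H" for m H k
    using UW[of m H] that by blast
  have U_sum: "Fract (U m H k) 1 = (\<Sum>q\<in>{1..\<nu> m H}. W m H q * T q ^ k)" for m H k
    using UW[of m H] by blast

  \<comment> \<open>The common block of a deep multiset; the choice is arbitrary on other multisets.\<close>
  define top where "top M = blk (SOME i. i \<in># M)" for M :: "'r multiset"
  define s where "s M = (\<Sum>j\<in>#M. dep j)" for M :: "'r multiset"
  define deep where "deep M \<longleftrightarrow> (\<exists>i\<in>#M. a (blk i) \<le> dep i \<and> (\<forall>j\<in>#M. blk j = blk i))" for M
  define F where "F M = (if deep M then U (top M) (image_mset hd M) (s M - a (top M)) else \<kappa> (pull b \<Phi> M))" for M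
  \<comment> \<open>Dividing by \<open>T q ^ a m\<close> turns the index \<open>s M - a m\<close> of the sequence into the exponent \<open>s M\<close>.\<close>
  define h where "h m q M = (if (\<forall>j\<in>#M. blk j = m) \<and> q \<le> \<nu> m (image_mset hd M)
      then W m (image_mset hd M) q * T q ^ s M / T q ^ a m else 0)" for m q and M :: "'r multiset"
  define g where "g x M = (case x of None \<Rightarrow> Fract (F M) 1 - (\<Sum>m\<in>Bl. \<Sum>q\<in>{1..n m - a m}. h m q M)
      | Some (m, q) \<Rightarrow> h m q M)" for x M
  have top: "top M = blk i" if "i \<in># M" "\<forall>j\<in>#M. blk j = blk i" for M i
  proof -
    have "(SOME i. i \<in># M) \<in># M"
      using that(1) by (rule someI)
    then show ?thesis
      using that(2) by (simp add: top_def)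
  qed
  have s_ge: "dep i \<le> s M" if "i \<in># M" for i M
    using multi_member_split[OF that] by (auto simp: s_def)
  have \<nu>_le: "\<nu> m (image_mset hd M) \<le> len m (hd i) - a m" if "i \<in># M" for m i M
    unfolding \<nu>_def using that by (intro diff_le_mono Min_le) auto

  have F_\<epsilon>: "\<epsilon> (F M) = pull b \<Phi> M" for M
  proof (cases "deep M")
    case True
    then obtain i where i: "i \<in># M" "a (blk i) \<le> dep i" "\<forall>j\<in>#M. blk j = blk i"
      unfolding deep_def by blast
    define m where "m = blk i"
    define H where "H = image_mset hd M"
    have s: "a m \<le> s M"
      using s_ge[OF i(1)] i(2) by (simp add: m_def)
    have F: "F M = U m H (s M - a m)"
      using True top[OF i(1,3)] by (simp add: F_def m_def H_def)
    have pull: "pull b \<Phi> M = chain_value m (s M) H"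
      using pull_deep[OF i] by (simp add: m_def H_def s_def)
    show ?thesis
    proof (cases "s M - a m < \<nu> m H")
      case True
      then show ?thesis
        using s by (simp add: F U_low \<epsilon>_\<kappa> pull)
    next
      case False
      have "Min (len m ` set_mset H) \<in> len m ` set_mset H"
        using i(1) by (intro Min_in) (auto simp: H_def)
      then obtain j where j: "j \<in># M" "Min (len m ` set_mset H) = len m (hd j)"
        by (auto simp: H_def)
      have "len m (hd j) \<le> s M"
        using False s j(2) by (simp add: \<nu>_def)
      moreover have "blk j = m"
        using i(3) j(1) by (simp add: m_def)
      ultimately have "chain_value m (s M) H = 0"
        using s j(1) len[of j] blk[of i]
        by (intro chain_value_eq_0[of m _ "hd j" _ "len m (hd j)"]) (auto simp: m_def H_def)
      then show ?thesis
        using False by (simp add: F U_high pull)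
    qed
  qed (simp add: F_def \<epsilon>_\<kappa>)
  have F_g: "Fract (F M) 1 = (\<Sum>x\<in>components. g x M)" for M
    by (simp add: sum_components g_def)
  have rest: "g None (add_mset i M) = 0" if i: "a (blk i) \<le> dep i" for i M
  proof (cases "\<forall>j\<in>#M. blk j = blk i")
    case True
    define m where "m = blk i"
    define M' where "M' = add_mset i M"
    define H where "H = image_mset hd M'"
    have M': "i \<in># M'" "\<forall>j\<in>#M'. blk j = m"
      using True by (simp_all add: M'_def m_def)
    have deep: "deep M'"
      unfolding deep_def using M' i m_def by blast
    have top_M': "top M' = m"
      using top[OF M'(1)] M'(2) unfolding m_def by blast
    have s: "a m \<le> s M'"
      using s_ge[OF M'(1)] i by (simp add: m_def)
    have \<nu>: "\<nu> m H \<le> n m - a m"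
      using \<nu>_le[OF M'(1), of m] len_le[of i] by (simp add: H_def m_def)
    have "Fract (F M') 1 = (\<Sum>q\<in>{1..\<nu> m H}. W m H q * T q ^ (s M' - a m))"
      using deep by (simp add: F_def U_sum top_M' H_def)
    also have "\<dots> = (\<Sum>q\<in>{1..\<nu> m H}. h m q M')"
    proof (intro sum.cong refl)
      fix q assume "q \<in> {1..\<nu> m H}"
      then have "h m q M' = W m H q * T q ^ s M' / T q ^ a m"
        using M'(2) by (simp add: h_def H_def m_def)
      also have "T q ^ s M' / T q ^ a m = T q ^ (s M' - a m)"
        using s T_nonzero by (simp add: power_diff)
      then have "W m H q * T q ^ s M' / T q ^ a m = W m H q * T q ^ (s M' - a m)"
        by (metis times_divide_eq_right)
      finally show "W m H q * T q ^ (s M' - a m) = h m q M'" ..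
    qed
    also have "\<dots> = (\<Sum>q\<in>{1..n m - a m}. h m q M')"
      using \<nu> by (intro sum.mono_neutral_left) (auto simp: h_def H_def)
    also have "\<dots> = (\<Sum>m'\<in>Bl. if m' = m then \<Sum>q\<in>{1..n m - a m}. h m q M' else 0)"
      using finite_Bl blk[of i] by (simp add: m_def)
    also have "\<dots> = (\<Sum>m'\<in>Bl. \<Sum>q\<in>{1..n m' - a m'}. h m' q M')"
      using M' by (intro sum.cong refl) (auto simp: h_def M'_def)
    finally show ?thesis
      by (simp add: g_def M'_def)
  next
    case False
    then obtain j where j: "j \<in># M" "blk j \<noteq> blk i"
      by blast
    then obtain M' where M: "M = add_mset j M'"
      by (metis insert_DiffM)
    have "\<not> deep (add_mset i M)"
      unfolding deep_def M by (metis add_mset_commute j(2) union_single_eq_member)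
    then have "Fract (F (add_mset i M)) 1 = 0"
      using pull_mixed[OF i j(2)] by (simp add: F_def M Fract_eq_0_iff1)
    moreover have "h m q (add_mset i M) = 0" for m q
      using j by (auto simp: h_def M)
    ultimately show ?thesis
      by (simp add: g_def)
  qed
  have "(\<chi> i. g x (add_mset i M)) \<in> component_space T x" if x: "x \<in> components" for x M
  proof (cases x)
    case None
    then show ?thesis
      using rest by (simp add: component_space_def)
  next
    case (Some mq)
    then obtain m q where mq: "x = Some (m, q)" and q: "m \<in> Bl" "1 \<le> q"
      using x by (cases mq) (auto simp: components_def)
    define z where "z y = (let H = add_mset y (image_mset hd M) in
      if (\<forall>j\<in>#M. blk j = m) \<and> q \<le> \<nu> m H then W m H q * T q ^ s M / T q ^ a m else 0)" for y
    have "q + a m \<le> len m y" if "z y \<noteq> 0" for y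
    proof -
      have "q \<le> \<nu> m (add_mset y (image_mset hd M))"
        using that by (auto simp: z_def Let_def split: if_splits)
      also have "\<dots> \<le> len m y - a m"
        unfolding \<nu>_def by (intro diff_le_mono Min_le) auto
      finally show ?thesis
        using q by simp
    qed
    moreover have "g x (add_mset i M) = (if blk i = m then z (hd i) * T q ^ dep i else 0)" for i
      by (auto simp: g_def mq h_def z_def Let_def s_def power_add)
    ultimately show ?thesis
      by (auto simp: component_space_def mq intro!: exI[of _ z])
  qed
  with F_\<epsilon> F_g that show ?thesis
    by blast
qed

text \<open>
  Each component space contains a nonzero vector with entries in the ring: for \<open>Some (m, q)\<close> take
  \<open>z = 1\<close> on all chains that are long enough; one exists because the longest chain of the
  block has length \<open>n m\<close>.
\<close>
lemma component_space_nonzero: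
  assumes "x \<in> components"
  obtains v :: "'r \<Rightarrow> 'a" and i where "(\<chi> i. Fract (v i) 1) \<in> component_space T x" "v i \<noteq> 0"
proof (cases x)
  case None
  define i0 :: 'r where "i0 = undefined"
  obtain i where i: "dep i = 0"
    using fill[of 0 i0] dep[of i0] by auto
  have "\<not> a (blk i) \<le> dep i"
    using a[OF blk, of i] i by simp
  then show ?thesis
    using that[of "\<lambda>j. if j = i then 1 else 0" i] None
    by (auto simp: component_space_def Fract_eq_0_iff1)
next
  case (Some mq)
  then obtain m q where mq: "x = Some (m, q)" and q: "m \<in> Bl" "q \<in> {1..n m - a m}"
    using assms by (cases mq) (auto simp: components_def)
  define v where "v i = (if blk i = m then if q + a m \<le> len m (hd i) then (\<tau> ^ q) ^ dep i else 0 else 0)" for i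
  have "a m < n m"
    using q(2) by auto
  then have "1 \<le> n m - 1"
    using a[OF q(1)] by linarith
  then obtain i where i: "blk i = m" "n m - 1 < len m (hd i)"
    using long[OF q(1) _ index[OF q(1) \<open>a m < n m\<close>]] by blast
  then have n_le: "n m \<le> len m (hd i)"
    by simp
  obtain i' where i': "blk i' = m" "hd i' = hd i" "dep i' = 0"
    using i(1) fill[of 0 i] dep[of i] by auto
  have "v i' \<noteq> 0"
    using n_le i' q(2) \<open>a m < n m\<close> le_diff_conv2[of "a m" "n m" q] by (simp add: v_def)
  moreover have "(\<chi> i. Fract (v i) 1) \<in> component_space T x"
    by (auto simp: component_space_def mq v_def T_def Fract_power1 Fract_eq_0_iff1
        intro!: exI[of _ "\<lambda>h. if q + a m \<le> len m h then 1 else 0"] split: if_splits)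
  ultimately show ?thesis
    using that by blast
qed

text \<open>
  A component that vanishes in degree \<open>d\<close> is replaced by \<open>\<tau>\<close> times the \<open>d\<close>-th divided power of a
  vector \<open>v\<close> in its space, whose coefficients are the products of entries of \<open>v\<close>. This term
  vanishes at \<open>\<tau> = 0\<close>.
\<close>
lemma deformed_form_nonzero:
  obtains F :: "'r multiset \<Rightarrow> 'a" and g :: "(nat \<times> nat) option \<Rightarrow> 'r multiset \<Rightarrow> 'a fract"
  where "\<And>M. \<epsilon> (F M) = pull b \<Phi> M"
    and "\<And>M. Fract (F M) 1 = (\<Sum>x\<in>components. g x M)"
    and "\<And>x M. x \<in> components \<Longrightarrow> (\<chi> i. g x (add_mset i M)) \<in> component_space T x"
    and "\<And>x. x \<in> components \<Longrightarrow> \<exists>M. size M = d \<and> g x M \<noteq> 0"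
proof -
  obtain F g where F: "\<And>M. \<epsilon> (F M) = pull b \<Phi> M"
    and Fg: "\<And>M. Fract (F M) 1 = (\<Sum>x\<in>components. g x M)"
    and g: "\<And>x M. x \<in> components \<Longrightarrow> (\<chi> i. g x (add_mset i M)) \<in> component_space T x"
    using deformed_form by blast
  have "\<exists>v :: 'r \<Rightarrow> 'a. (\<chi> i. Fract (v i) 1) \<in> component_space T x \<and> (\<exists>i. v i \<noteq> 0)" if "x \<in> components" for x
    using component_space_nonzero[OF that] by metis
  then obtain v :: "(nat \<times> nat) option \<Rightarrow> 'r \<Rightarrow> 'a" where
    v: "\<And>x. x \<in> components \<Longrightarrow> (\<chi> i. Fract (v x i) 1) \<in> component_space T x" "\<And>x. x \<in> components \<Longrightarrow> \<exists>i. v x i \<noteq> 0"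
    by metis
  define e where "e x M = (if \<forall>M. size M = d \<longrightarrow> g x M = 0 then \<tau> * (\<Prod>i\<in>#M. v x i) else 0)" for x M
  show ?thesis
  proof (rule that[of "\<lambda>M. F M + (\<Sum>x\<in>components. e x M)" "\<lambda>x M. g x M + Fract (e x M) 1"])
    fix M
    show "\<epsilon> (F M + (\<Sum>x\<in>components. e x M)) = pull b \<Phi> M"
      by (auto simp: \<epsilon>_add \<epsilon>_sum F e_def \<epsilon>_mult \<epsilon>_\<tau> intro!: sum.neutral)
    show "Fract (F M + (\<Sum>x\<in>components. e x M)) 1 = (\<Sum>x\<in>components. g x M + Fract (e x M) 1)"
      unfolding Fract_add1 Fract_sum1 Fg by (simp only: sum.distrib)
  next
    fix x assume x: "x \<in> components"
    show "\<exists>M. size M = d \<and> g x M + Fract (e x M) 1 \<noteq> 0"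
    proof (cases "\<forall>M. size M = d \<longrightarrow> g x M = 0")
      case True
      obtain i where "v x i \<noteq> 0"
        using v(2)[OF x] by blast
      then have "e x (replicate_mset d i) \<noteq> 0"
        using True \<tau>_nonzero by (simp add: e_def)
      then show ?thesis
        using True by (intro exI[of _ "replicate_mset d i"]) (simp add: Fract_eq_0_iff1)
    next
      case False
      then obtain M where M: "size M = d" "g x M \<noteq> 0"
        by blast
      moreover have "Fract (e x M) 1 = 0"
        by (simp only: e_def False if_False Fract_eq_0_iff1)
      ultimately show ?thesis
        by (intro exI[of _ M]) simp
    qed
    fix M
    have "(\<chi> i. g x (add_mset i M) + Fract (e x (add_mset i M)) 1) =
        (\<chi> i. g x (add_mset i M)) + Fract (e x M) 1 *s (\<chi> i. Fract (v x i) 1)"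
      by (auto simp: vec_eq_iff e_def Fract_eq_0_iff1 ac_simps)
    also have "\<dots> \<in> component_space T x"
      by (intro vec.subspace_add[OF subspace_component_space] vec.subspace_scale[OF subspace_component_space] g v x)
    finally show "(\<chi> i. g x (add_mset i M) + Fract (e x (add_mset i M)) 1) \<in> component_space T x" .
  qed
qed

end

section \<open>Splitting over the field of rational functions\<close>

lemma matrix_add_rdistrib: "(A + B) ** C = A ** C + B ** (C :: 'a::field ^ 'n ^ 'm::finite)"
  by (vector matrix_matrix_mult_def sum.distrib[symmetric] distrib_right)

lemma matrix_diff_ldistrib: "A ** (B - C) = A ** B - A ** (C :: 'a::field ^ 'n ^ 'm::finite)"
  by (vector matrix_matrix_mult_def sum_subtractf[symmetric] right_diff_distrib)

lemma matrix_diff_rdistrib: "(A - B) ** C = A ** C - B ** (C :: 'a::field ^ 'n ^ 'm::finite)"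
  by (vector matrix_matrix_mult_def sum_subtractf[symmetric] left_diff_distrib)

lemma sum_matrix_mult: "(\<Sum>i\<in>S. f i) ** B = (\<Sum>i\<in>S. f i ** B)"
  for f :: "'i \<Rightarrow> 'a::field ^ 'n ^ 'm::finite"
  by (induction S rule: infinite_finite_induct) (simp_all add: matrix_add_rdistrib)

lemma matrix_mult_sum: "B ** (\<Sum>i\<in>S. f i) = (\<Sum>i\<in>S. B ** f i)"
  for f :: "'i \<Rightarrow> 'a::field ^ 'n ^ 'm::finite"
  by (induction S rule: infinite_finite_induct) (simp_all add: matrix_add_ldistrib)

lemma lookup_mult_0:
  "Poly_Mapping.lookup (p * q) 0 = Poly_Mapping.lookup p 0 * Poly_Mapping.lookup (q :: ('t, 'k::field) mpoly) 0"
proof -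
  have "Poly_Mapping.lookup (p * q) 0 = (\<Sum>l. Poly_Mapping.lookup p l * (\<Sum>k. Poly_Mapping.lookup q k when 0 = l + k))"
    by (simp add: lookup_mult)
  also have "(\<lambda>l. Poly_Mapping.lookup p l * (\<Sum>k. Poly_Mapping.lookup q k when 0 = l + k)) =
      (\<lambda>l. Poly_Mapping.lookup p 0 * Poly_Mapping.lookup q 0 when l = 0)"
  proof
    fix l :: "'t \<Rightarrow>\<^sub>0 nat"
    have "0 = l + k \<longleftrightarrow> l = 0 \<and> k = 0" for k
      by (auto simp: poly_mapping_eq_iff fun_eq_iff lookup_add)
    then show "Poly_Mapping.lookup p l * (\<Sum>k. Poly_Mapping.lookup q k when 0 = l + k) =
      (Poly_Mapping.lookup p 0 * Poly_Mapping.lookup q 0 when l = 0)"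
      by (cases "l = 0") simp_all
  qed
  finally show ?thesis
    by simp
qed

lemma pvar_power: "pvar v ^ q = Poly_Mapping.single (Poly_Mapping.single v q) (1 :: 'k::field)"
  by (induction q) (simp_all add: pvar_def mult_single single_add[symmetric] single_one)

lemma poly_eval_0: "poly_eval (\<lambda>_. 0) p = Poly_Mapping.lookup p 0"
  for p :: "('t::finite, 'k::field) mpoly"
proof -
  have prod: "(\<Prod>i\<in>UNIV. 0 ^ Poly_Mapping.lookup \<alpha> i) = (if \<alpha> = 0 then 1 else 0 :: 'k)" for \<alpha> :: "'t \<Rightarrow>\<^sub>0 nat"
  proof (cases "\<alpha> = 0")
    case False
    then obtain i where "Poly_Mapping.lookup \<alpha> i \<noteq> 0"
      by (metis lookup_zero poly_mapping_eqI)
    then show ?thesis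
      using False by (auto intro!: prod_zero bexI[of _ i])
  qed simp
  have "poly_eval (\<lambda>_. 0) p = (\<Sum>\<alpha>\<in>Poly_Mapping.keys p. if \<alpha> = 0 then Poly_Mapping.lookup p 0 else 0)"
    unfolding poly_eval_def prod by (intro sum.cong) auto
  then show ?thesis
    by (simp add: in_keys_iff)
qed

lemma deformation_parameter_pvar:
  "deformation_parameter (pvar v :: ('t::{finite,linorder}, 'k::field) mpoly)
    (\<lambda>p. Poly_Mapping.lookup p 0) (Poly_Mapping.single 0)"
proof
  show "inj_on (\<lambda>q. pvar v ^ q :: ('t, 'k) mpoly) {1::nat..}"
    by (rule inj_onI) (simp add: pvar_power, metis lookup_single_eq lookup_single_not_eq one_neq_zero)
  show "Poly_Mapping.lookup (pvar v :: ('t, 'k) mpoly) 0 = 0"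
    unfolding pvar_def by (rule lookup_single_not_eq) (metis lookup_single_eq lookup_zero zero_neq_one)
qed (simp_all add: lookup_add lookup_mult_0 single_add mult_single single_one)

text \<open>
  Return from chain coordinates to the given ones by the inverse \<open>c\<close> of the basis matrix \<open>b\<close>. Both
  matrices have constant entries, so specialization commutes with the change of
  coordinates, and the independence of the component spaces is preserved.
\<close>
lemma (in chain_data) splitting_deformation:
  assumes f: "f \<in> forms d" and \<Phi>: "\<Phi> = (\<lambda>M. Poly_Mapping.lookup f (expo M))" and d: "d \<ge> 1"
    and N: "N = (\<Sum>m\<in>Bl. n m - a m)"
  shows "\<exists>ft :: ('r, ('t::{finite,linorder}, 'k) mpoly) divpow. ft \<in> forms d \<and> specialize (\<lambda>_. 0) ft = f \<and>
    splits_regularly N d (to_fraction_field ft)"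
proof -
  define v :: 't where "v = undefined"
  interpret chain_deformation Bl A E b blk dep hd len a n \<Phi> "pvar v :: ('t, 'k) mpoly"
    "\<lambda>p. Poly_Mapping.lookup p 0" "Poly_Mapping.single 0"
    by (intro chain_deformation.intro chain_data_axioms deformation_parameter_pvar)
  obtain F :: "'r multiset \<Rightarrow> ('t, 'k) mpoly" and g where F: "\<And>M. Poly_Mapping.lookup (F M) 0 = pull b \<Phi> M"
    and Fg: "\<And>M. Fract (F M) 1 = (\<Sum>x\<in>components. g x M)"
    and g: "\<And>x M. x \<in> components \<Longrightarrow> (\<chi> i. g x (add_mset i M)) \<in> component_space T x"
    and g_nz: "\<And>x. x \<in> components \<Longrightarrow> \<exists>M. size M = d \<and> g x M \<noteq> 0"
    by (rule deformed_form_nonzero[of d]) (rule that, assumption+)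
  obtain c where bc: "b ** c = mat 1" "c ** b = mat 1"
    using inv_b by (auto simp: invertible_def)
  define \<kappa> where "\<kappa> = (Poly_Mapping.single 0 :: 'k \<Rightarrow> ('t, 'k) mpoly)"
  define cP where "cP = (\<chi> i j. \<kappa> (c $ i $ j))"
  define cF where "cF = (\<chi> i j. Fract (\<kappa> (c $ i $ j)) 1)"
  define bF where "bF = (\<chi> i j. Fract (\<kappa> (b $ i $ j)) 1)"
  have bcF: "bF ** cF = mat 1"
  proof -
    have "(bF ** cF) $ i $ j = Fract (\<kappa> ((b ** c) $ i $ j)) 1" for i j
      by (simp add: bF_def cF_def matrix_matrix_mult_def \<kappa>_def \<kappa>_sum \<kappa>_mult Fract_sum1)
    also have "\<dots> i j = (mat 1 :: ('t, 'k) mpoly fract ^ 'r ^ 'r) $ i $ j" for i j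
      by (simp add: bc mat_def \<kappa>_def \<kappa>_1 One_fract_def Zero_fract_def)
    finally show ?thesis
      by (simp add: vec_eq_iff)
  qed
  define ft where "ft = form_of d (pull cP F)"
  have "specialize (\<lambda>_. 0) ft = f"
  proof (rule poly_mapping_eqI)
    fix \<alpha>
    have "Poly_Mapping.lookup (specialize (\<lambda>_. 0) ft) \<alpha> = Poly_Mapping.lookup (Poly_Mapping.lookup ft \<alpha>) 0"
      by (simp add: specialize_def poly_eval_0 map.rep_eq when_def)
    also have "\<dots> = (if mdeg \<alpha> = d then pull c (pull b \<Phi>) (mset_of \<alpha>) else 0)"
    proof -
      have "Poly_Mapping.lookup (pull cP F M) 0 = pull c (pull b \<Phi>) M" for M
        unfolding pull_def[of cP] by (subst mform_hom) 
          (simp_all add: lookup_add lookup_mult_0 F pull_def[of c] cP_def \<kappa>_def multiset.map_comp comp_def)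
      then show ?thesis
        by (simp add: ft_def)
    qed
    also have "\<dots> = Poly_Mapping.lookup f \<alpha>"
      using f by (simp add: pull_pull bc \<Phi> forms_lookup_eq_0)
    finally show "Poly_Mapping.lookup (specialize (\<lambda>_. 0) ft) \<alpha> = Poly_Mapping.lookup f \<alpha>" .
  qed
  moreover have "to_fraction_field ft = form_of d (\<lambda>M. \<Sum>x\<in>components. pull cF (g x) M)"
  proof (rule poly_mapping_eqI)
    fix \<alpha>
    have "Fract (pull cP F M) 1 = (\<Sum>x\<in>components. pull cF (g x) M)" for M
    proof -
      have rows: "image_mset (\<lambda>u. \<chi> i. Fract (u $ i) 1) (image_mset (\<lambda>i. cP $ i) M) =
          image_mset (\<lambda>i. cF $ i) M"
        unfolding multiset.map_comp by (intro image_mset_cong) (simp add: vec_eq_iff cP_def cF_def)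
      have "Fract (pull cP F M) 1 = pull cF (\<lambda>M. Fract (F M) 1) M"
        unfolding pull_def rows[symmetric] by (rule mform_hom) simp_all
      then show ?thesis
        unfolding Fg by (simp add: pull_def mform_sum1)
    qed
    moreover have "Poly_Mapping.lookup (to_fraction_field ft) \<alpha> = Fract (Poly_Mapping.lookup ft \<alpha>) 1"
      by (auto simp: to_fraction_field_def map.rep_eq when_def Fract_eq_0_iff1)
    ultimately show "Poly_Mapping.lookup (to_fraction_field ft) \<alpha> =
        Poly_Mapping.lookup (form_of d (\<lambda>M. \<Sum>x\<in>components. pull cF (g x) M)) \<alpha>"
      by (simp add: ft_def Fract_eq_0_iff1)
  qed
  moreover have "splits_regularly N d (form_of d (\<lambda>M. \<Sum>x\<in>components. pull cF (g x) M))"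
  proof (rule splits_regularly_criterion[where V = "\<lambda>x. (*v) cF ` component_space T x"])
    show "vec.subspace ((*v) cF ` component_space T x)" for x
      by (intro vec.subspace_image subspace_component_space)
    fix y assume y: "\<And>x. x \<in> components \<Longrightarrow> y x \<in> (*v) cF ` component_space T x" and y0: "(\<Sum>x\<in>components. y x) = 0"
    have "\<forall>x\<in>components. \<exists>z. z \<in> component_space T x \<and> y x = cF *v z"
      using y by blast
    then obtain z where z: "\<And>x. x \<in> components \<Longrightarrow> z x \<in> component_space T x" "\<And>x. x \<in> components \<Longrightarrow> y x = cF *v z x"
      by metis
    have "(\<Sum>x\<in>components. z x) = bF *v (\<Sum>x\<in>components. y x)"
      by (simp add: z(2) vec.sum matrix_vector_mul_assoc bcF)
    then have "\<forall>x\<in>components. z x = 0"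
      using y0 z(1) by (intro component_spaces_independent[OF inj_T T_nonzero]) auto
    then show "\<forall>x\<in>components. y x = 0"
      by (simp add: z(2))
  next
    fix x assume x: "x \<in> components"
    show "(\<chi> i. pull cF (g x) (add_mset i M)) \<in> (*v) cF ` component_space T x" for M
      by (rule pull_mem_image[OF subspace_component_space g[OF x]])
    obtain M where M: "size M = d" "g x M \<noteq> 0"
      using g_nz[OF x] by blast
    show "\<exists>M. size M = d \<and> pull cF (g x) M \<noteq> 0"
    proof (rule ccontr)
      assume "\<not> ?thesis"
      then have "pull bF (pull cF (g x)) M = pull bF (\<lambda>_. 0) M"
        using M(1) unfolding pull_def[of bF] by (intro mform_cong_size) auto
      then show False
        using M(2) by (simp add: pull_pull bcF) (simp add: pull_def)
    qed
  qed (use d in \<open>simp_all add: finite_components card_components N\<close>)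
  ultimately show ?thesis
    using form_of_in_forms[of d "pull cP F"] ft_def by metis
qed

lemma matpow_nil_index:
  assumes "nilpotent_mat A"
  shows "matpow A (nil_index A) = 0"
    and "1 \<le> k \<Longrightarrow> k < nil_index A \<Longrightarrow> matpow A k \<noteq> 0"
proof -
  obtain k where "1 \<le> k \<and> matpow A k = 0"
    using assms by (auto simp: nilpotent_mat_def)
  from LeastI[of "\<lambda>k. 1 \<le> k \<and> matpow A k = 0", OF this]
  show "matpow A (nil_index A) = 0"
    by (simp add: nil_index_def)
  show "matpow A k \<noteq> 0" if "1 \<le> k" "k < nil_index A" for k
    using that not_less_Least[of k "\<lambda>k. 1 \<le> k \<and> matpow A k = 0"] by (auto simp: nil_index_def)
qed

theorem theorem4p11:
  fixes f :: "('r::finite, 'k::field) divpow"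
    and A E :: "nat \<Rightarrow> 'k ^ 'r ^ 'r"
    and a :: "nat \<Rightarrow> nat"
    and d m n :: nat
  assumes "d \<ge> 3"
    and "f \<in> forms d"
    and "\<forall>i\<in>{1..m}. A i \<noteq> 0 \<and> nilpotent_mat (A i)"
    and "orthogonal_idempotents {1..m} E"
    and "\<forall>i\<in>{1..m}. E i ** A i = A i \<and> A i ** E i = A i"
    and "\<forall>i\<in>{1..m}. 1 \<le> a i \<and> a i < nil_index (A i)"
    and "\<forall>i\<in>{1..m}. \<forall>k\<ge>a i. matpow (A i) k \<in> M_alg f"
    and "n = (\<Sum>i=1..m. nil_index (A i) - a i)"
    and "CARD('t::{finite,linorder}) = n"
  shows "\<exists>ft :: ('r, ('t, 'k) mpoly) divpow.
           ft \<in> forms d \<and>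
           specialize (\<lambda>_. 0) ft = f \<and>
           splits_regularly n d (to_fraction_field ft)"
proof -
  \<comment> \<open>The complement of the ranges of the \<open>E i\<close> is a block of index \<open>0\<close> with zero matrix; with \<open>a = n = 1\<close> it adds nothing to the sum.\<close>
  define A' where "A' i = (if i = 0 then 0 else A i)" for i
  define E' where "E' i = (if i = 0 then mat 1 - (\<Sum>j\<in>{1..m}. E j) else E i)" for i
  define a' where "a' i = (if i = 0 then 1 else a i)" for i
  define n' where "n' i = (if i = 0 then 1 else nil_index (A i))" for i
  define \<Phi> where "\<Phi> = (\<lambda>M. Poly_Mapping.lookup f (expo M))"
  have EE: "E i ** E j = (if i = j then E i else 0)" if "i \<in> {1..m}" "j \<in> {1..m}" for i j
    using assms(4) that by (auto simp: orthogonal_idempotents_def)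
  have E0: "E' 0 ** E i = 0" "E i ** E' 0 = 0" if "i \<in> {1..m}" for i
  proof -
    have "(\<Sum>j\<in>{1..m}. E j ** E i) = (\<Sum>j\<in>{1..m}. if j = i then E i else 0)"
      "(\<Sum>j\<in>{1..m}. E i ** E j) = (\<Sum>j\<in>{1..m}. if j = i then E i else 0)"
      using that EE by (auto intro!: sum.cong)
    then show "E' 0 ** E i = 0" "E i ** E' 0 = 0"
      using that by (simp_all add: E'_def matrix_diff_ldistrib matrix_diff_rdistrib
          sum_matrix_mult matrix_mult_sum)
  qed
  have idem: "E' i ** E' i = E' i" if "i \<in> {0..m}" for i
  proof (cases "i = 0")
    case True
    have "E' 0 ** E' 0 = E' 0 - E' 0 ** (\<Sum>j\<in>{1..m}. E j)"
      by (simp add: E'_def[of 0] matrix_diff_ldistrib)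
    also have "E' 0 ** (\<Sum>j\<in>{1..m}. E j) = 0"
      by (simp add: matrix_mult_sum E0)
    finally show ?thesis
      using True by simp
  qed (use that EE in \<open>auto simp: E'_def\<close>)
  have orth: "E' i ** E' j = 0" if "i \<in> {0..m}" "j \<in> {0..m}" "i \<noteq> j" for i j
    using that E0 EE by (cases "i = 0"; cases "j = 0") (auto simp: E'_def[of i] E'_def[of j])
  have total: "(\<Sum>i\<in>{0..m}. E' i) = mat 1"
  proof -
    have "(\<Sum>i\<in>{0..m}. E' i) = E' 0 + (\<Sum>i\<in>{1..m}. E' i)"
      by (simp add: sum.atLeast_Suc_atMost)
    also have "(\<Sum>i\<in>{1..m}. E' i) = (\<Sum>i\<in>{1..m}. E i)"
      by (intro sum.cong) (auto simp: E'_def)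
    finally show ?thesis
      by (simp add: E'_def)
  qed
  have EA: "E' i ** A' i = A' i" "A' i ** E' i = A' i" if "i \<in> {0..m}" for i
    using assms(5) that by (auto simp: E'_def A'_def)
  have pow0: "matpow (0 :: 'k ^ 'r ^ 'r) k = 0" if "1 \<le> k" for k
    using that by (cases k) (simp_all add: matpow_def)
  have nilp: "matpow (A' i) (n' i) = 0" if "i \<in> {0..m}" for i
    using assms(3) that pow0[of 1] matpow_nil_index(1)[of "A i"] by (auto simp: A'_def n'_def)
  obtain b blk dep hd len where basis: "chain_basis {0..m} A' E' b blk dep hd len"
    using joint_chain_basis[of "{0..m}" E' A' n'] idem orth total EA nilp by blast
  interpret chain_data "{0..m}" A' E' b blk dep hd len a' n' \<Phi>
  proof (intro chain_data.intro basis chain_data_axioms.intro)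
    show "1 \<le> a' i" if "i \<in> {0..m}" for i
      using assms(6) that by (auto simp: a'_def)
    show "matpow (A' i) (n' i - 1) \<noteq> 0" if i: "i \<in> {0..m}" "a' i < n' i" for i
    proof -
      have "i \<noteq> 0"
        using i(2) by (cases "i = 0") (simp_all add: a'_def n'_def)
      then have i1: "i \<in> {1..m}" and n'_i: "n' i = nil_index (A i)"
        using i(1) by (simp_all add: n'_def)
      with assms(6) have "1 \<le> a i" "a i < nil_index (A i)"
        by simp_all
      then have "1 \<le> n' i - 1" "n' i - 1 < nil_index (A i)"
        unfolding n'_i by linarith+
      with i1 show ?thesis
        using matpow_nil_index(2)[of "A i" "n' i - 1"] assms(3) \<open>i \<noteq> 0\<close> by (simp add: A'_def)
    qed
    show "ddir (u v* matpow (A' i) k) (ddir v \<Phi>) = ddir u (ddir (v v* matpow (A' i) k) \<Phi>)"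
      if "i \<in> {0..m}" "a' i \<le> k" for i k u v
    proof (cases "i = 0")
      case True
      then have "matpow (A' i) k = 0"
        using that by (simp add: A'_def a'_def pow0)
      then show ?thesis
        by simp
    next
      case False
      then have "matpow (A' i) k \<in> M_alg f"
        using assms(7) that by (auto simp: A'_def a'_def)
      then show ?thesis
        unfolding \<Phi>_def by (rule M_alg_ddir)
    qed
  qed (use orth EA nilp in simp_all)
  have "n = (\<Sum>i\<in>{0..m}. n' i - a' i)"
    by (auto simp: sum.atLeast_Suc_atMost assms(8) a'_def n'_def intro!: sum.cong)
  then show ?thesis
    using assms(1,2) \<Phi>_def by (intro splitting_deformation[of f d n]) auto
qed

end
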